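(* There is an algorithm that, given a DAG $D=(V,A)$, computes in $O(|V|+|A|)$ time a set $B\subseteq A$ such that $D-B$ is a funnel and $|B|\le 2d$, where $d$ is the minimum size of a set $A'\subseteq A$ such that $D-A'$ is a funnel. That is, Arc-Deletion Distance to a Funnel admits a linear-time factor-two approximation.
   Context: A source is a vertex of in-degree $0$, a sink a vertex of out-degree $0$. In a DAG, an arc is private if exactly one directed source-to-sink path contains it. A funnel is a finite DAG in which every directed source-to-sink path contains at least one private arc. The arc-deletion distance to a funnel of a DAG $D$ is the minimum number of arcs whose deletion from $D$ yields a funnel. *)

theory Defs
  imports Graph_Theory.Pair_Digraph
begin

section \<open>Funnels\<close>

definition dag :: "'v pair_pre_digraph \<Rightarrow> bool" where
  "dag D \<longleftrightarrow> pair_fin_digraph D \<and> acyclic (parcs D)"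

definition is_source :: "'v pair_pre_digraph \<Rightarrow> 'v \<Rightarrow> bool" where
  "is_source D v \<longleftrightarrow> v \<in> pverts D \<and> in_degree D v = 0"

definition is_sink :: "'v pair_pre_digraph \<Rightarrow> 'v \<Rightarrow> bool" where
  "is_sink D v \<longleftrightarrow> v \<in> pverts D \<and> out_degree D v = 0"

text \<open>
  A path is given by its list of arcs. An isolated vertex is both a source and a sink; the path
  without arcs at such a vertex is not counted as a source-to-sink path, since otherwise no digraph
  with an isolated vertex would be a funnel and some DAGs could not be turned into a funnel by
  deleting arcs.
\<close>

definition source_sink_path :: "'v pair_pre_digraph \<Rightarrow> ('v \<times> 'v) list \<Rightarrow> bool" where
  "source_sink_path D p \<longleftrightarrow>
     p \<noteq> [] \<and> (\<exists>u v. is_source D u \<and> is_sink D v \<and> pre_digraph.apath D u p v)"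

definition private_arc :: "'v pair_pre_digraph \<Rightarrow> 'v \<times> 'v \<Rightarrow> bool" where
  "private_arc D a \<longleftrightarrow> a \<in> parcs D \<and> (\<exists>!p. source_sink_path D p \<and> a \<in> set p)"

definition funnel :: "'v pair_pre_digraph \<Rightarrow> bool" where
  "funnel D \<longleftrightarrow>
     dag D \<and> (\<forall>p. source_sink_path D p \<longrightarrow> (\<exists>a \<in> set p. private_arc D a))"

definition delete_arcs :: "'v pair_pre_digraph \<Rightarrow> ('v \<times> 'v) set \<Rightarrow> 'v pair_pre_digraph" where
  "delete_arcs D B = D\<lparr>parcs := parcs D - B\<rparr>"

definition funnel_distance :: "'v pair_pre_digraph \<Rightarrow> nat" where
  "funnel_distance D =
     (LEAST k. \<exists>A' \<subseteq> parcs D. funnel (delete_arcs D A') \<and> card A' = k)"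

lemma funnel_delete_all_arcs:
  assumes "dag D"
  shows "funnel (delete_arcs D (parcs D))"
proof -
  interpret pair_fin_digraph D using assms by (simp add: dag_def)
  have "pair_fin_digraph (delete_arcs D (parcs D))"
    by unfold_locales (auto simp: delete_arcs_def pair_finite_verts)
  moreover have "\<not> source_sink_path (delete_arcs D (parcs D)) p" for p
    by (auto simp: source_sink_path_def delete_arcs_def pre_digraph.apath_def
        pre_digraph.awalk_def)
  ultimately show ?thesis
    by (auto simp: funnel_def dag_def delete_arcs_def acyclic_def)
qed


section \<open>Word RAM programs\<close>

text \<open>
  Programs of a random access machine, written in structured form. The storage consists of named
  registers and named arrays of natural numbers; the names are part of the program text, so each
  program uses constantly many of them, and only array cells are addressed indirectly. Every
  assignment and every evaluation of a test is one elementary operation on a bounded number of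
  operands and takes one unit of time.

  To keep unit cost realistic, the run is relative to a largest machine word w: a computation
  that would store, or address an array by, a number larger than w gets stuck and has no run.
\<close>

datatype operand = Const nat | Reg string

datatype expression =
    Val operand
  | Add operand operand
  | Sub operand operand
  | Load string operand

datatype test =
    Less operand operand
  | Equal operand operand
  | Unequal operand operand

datatype program =
    Skip
  | Assign string expression
  | Store string operand operand
  | Seq program program
  | If test program program
  | While test program

record state =
  regs :: "string \<Rightarrow> nat"
  cells :: "string \<Rightarrow> nat \<Rightarrow> nat"

primrec operand_val :: "operand \<Rightarrow> state \<Rightarrow> nat" where
  "operand_val (Const k) s = k"
| "operand_val (Reg x) s = regs s x"

primrec expression_val :: "expression \<Rightarrow> state \<Rightarrow> nat" where
  "expression_val (Val a) s = operand_val a s"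
| "expression_val (Add a b) s = operand_val a s + operand_val b s"
| "expression_val (Sub a b) s = operand_val a s - operand_val b s"
| "expression_val (Load X a) s = cells s X (operand_val a s)"

primrec address_ok :: "nat \<Rightarrow> expression \<Rightarrow> state \<Rightarrow> bool" where
  "address_ok w (Val a) s \<longleftrightarrow> True"
| "address_ok w (Add a b) s \<longleftrightarrow> True"
| "address_ok w (Sub a b) s \<longleftrightarrow> True"
| "address_ok w (Load X a) s \<longleftrightarrow> operand_val a s \<le> w"

primrec test_val :: "test \<Rightarrow> state \<Rightarrow> bool" where
  "test_val (Less a b) s \<longleftrightarrow> operand_val a s < operand_val b s"
| "test_val (Equal a b) s \<longleftrightarrow> operand_val a s = operand_val b s"
| "test_val (Unequal a b) s \<longleftrightarrow> operand_val a s \<noteq> operand_val b s"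

text \<open>
  \<open>run w P s t s'\<close>: started in \<open>s\<close>, the program \<open>P\<close> halts after \<open>t\<close> time units in \<open>s'\<close>.
\<close>

inductive run :: "nat \<Rightarrow> program \<Rightarrow> state \<Rightarrow> nat \<Rightarrow> state \<Rightarrow> bool" for w :: nat where
  Skip: "run w Skip s 1 s"
| Assign: "address_ok w e s \<Longrightarrow> expression_val e s \<le> w \<Longrightarrow>
    run w (Assign x e) s 1 (s\<lparr>regs := (regs s)(x := expression_val e s)\<rparr>)"
| Store: "operand_val a s \<le> w \<Longrightarrow> operand_val b s \<le> w \<Longrightarrow>
    run w (Store X a b) s 1
      (s\<lparr>cells := (cells s)(X := (cells s X)(operand_val a s := operand_val b s))\<rparr>)"
| Seq: "run w P s t1 s' \<Longrightarrow> run w Q s' t2 s'' \<Longrightarrow> run w (Seq P Q) s (t1 + t2) s''"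
| IfTrue: "test_val b s \<Longrightarrow> run w P s t s' \<Longrightarrow> run w (If b P Q) s (1 + t) s'"
| IfFalse: "\<not> test_val b s \<Longrightarrow> run w Q s t s' \<Longrightarrow> run w (If b P Q) s (1 + t) s'"
| WhileFalse: "\<not> test_val b s \<Longrightarrow> run w (While b P) s 1 s"
| WhileTrue: "test_val b s \<Longrightarrow> run w P s t1 s' \<Longrightarrow> run w (While b P) s' t2 s'' \<Longrightarrow>
    run w (While b P) s (1 + t1 + t2) s''"

inductive_cases run_SkipE: "run w Skip s t s'"
inductive_cases run_AssignE: "run w (Assign x e) s t s'"
inductive_cases run_StoreE: "run w (Store X a b) s t s'"
inductive_cases run_SeqE: "run w (Seq P Q) s t s'"
inductive_cases run_IfE: "run w (If b P Q) s t s'"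
inductive_cases run_WhileE: "run w (While b P) s t s'"

lemma run_deterministic:
  "run w P s t s' \<Longrightarrow> run w P s u s'' \<Longrightarrow> u = t \<and> s'' = s'"
proof (induction arbitrary: u s'' rule: run.induct)
  case (Skip s)
  then show ?case by (auto elim: run_SkipE)
next
  case (Assign e s x)
  from Assign.prems show ?case by (rule run_AssignE) simp
next
  case (Store a s b X)
  from Store.prems show ?case by (rule run_StoreE) simp
next
  case (Seq P s t1 s1 Q t2 s2)
  from Seq.prems show ?case
  proof (rule run_SeqE)
    fix u1 r u2
    assume "u = u1 + u2" "run w P s u1 r" "run w Q r u2 s''"
    then show ?thesis using Seq.IH(1)[of u1 r] Seq.IH(2)[of u2 s''] by simp
  qed
next
  case (IfTrue b s P t s1 Q)
  from IfTrue.prems show ?case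
    by (rule run_IfE) (use IfTrue.IH IfTrue.hyps(1) in auto)
next
  case (IfFalse b s Q t s1 P)
  from IfFalse.prems show ?case
    by (rule run_IfE) (use IfFalse.IH IfFalse.hyps(1) in auto)
next
  case (WhileFalse b s P)
  from WhileFalse.prems show ?case
    by (rule run_WhileE) (use WhileFalse.hyps in auto)
next
  case (WhileTrue b s P t1 s1 t2 s2)
  from WhileTrue.prems show ?case
  proof (cases rule: run.cases)
    case W: (WhileTrue u1 r u2)
    show ?thesis
      using W WhileTrue.IH(1)[of u1 r] WhileTrue.IH(2)[of u2 s''] by simp
  qed (use WhileTrue.hyps(1) in simp_all)
qed


section \<open>Input and output\<close>

text \<open>
  The vertices are numbered by their positions in the list \<open>vs\<close>, and a digraph is presented to
  the machine as the list \<open>es\<close> of its arcs in arbitrary order, each arc being the pair of the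
  numbers of its tail and its head. The machine sees only these numbers.
\<close>

definition named_arc :: "'v list \<Rightarrow> nat \<times> nat \<Rightarrow> 'v \<times> 'v" where
  "named_arc vs = (\<lambda>(i, j). (vs ! i, vs ! j))"

definition presents :: "'v list \<Rightarrow> (nat \<times> nat) list \<Rightarrow> 'v pair_pre_digraph \<Rightarrow> bool" where
  "presents vs es D \<longleftrightarrow>
     distinct vs \<and> set vs = pverts D \<and>
     distinct es \<and> set es \<subseteq> {..<length vs} \<times> {..<length vs} \<and>
     named_arc vs ` set es = parcs D"

definition input_state :: "nat \<Rightarrow> (nat \<times> nat) list \<Rightarrow> state" where
  "input_state n es =
     \<lparr>regs = (\<lambda>_. 0)(''n'' := n, ''m'' := length es),
      cells = (\<lambda>_ _. 0)
        (''tail'' := (\<lambda>k. if k < length es then fst (es ! k) else 0),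
         ''head'' := (\<lambda>k. if k < length es then snd (es ! k) else 0))\<rparr>"

text \<open>The output array marks the positions in \<open>es\<close> of the selected arcs.\<close>

definition output_arcs :: "'v list \<Rightarrow> (nat \<times> nat) list \<Rightarrow> state \<Rightarrow> ('v \<times> 'v) set" where
  "output_arcs vs es s = {named_arc vs (es ! k) | k. k < length es \<and> cells s ''out'' k \<noteq> 0}"

end

theory Submission
  imports Defs
begin

text \<open>
  A DAG is a funnel iff its vertices split into a part \<open>F\<close>, each vertex of which has at most one in-arc, and a
  part \<open>M\<close>, each vertex of which has at most one out-arc, with no arc from \<open>M\<close> to \<open>F\<close>. Call the in-arcs of a
  vertex of \<open>F\<close> and the out-arcs of a vertex of \<open>M\<close> the arcs on its side. A deletion set loses at each vertex
  all but at most one of the arcs on its side, and it loses each arc at no more than two vertices, so twice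
  its size is at least the sum of \<open>min (indeg v) (outdeg v) - 1\<close>.

  The algorithm puts \<open>v\<close> into \<open>F\<close> if \<open>indeg v < outdeg v\<close> and into \<open>M\<close> if \<open>outdeg v < indeg v\<close>, and lets each
  vertex delete all arcs on its side except at most one that it keeps. An arc from \<open>M\<close> to \<open>F\<close> then survives
  only if both of its ends keep it. Vertices with equal degrees take whatever side lets them keep an arc to a
  vertex reached earlier by a graph search. The search starts at the seeds, which keep an arc to a vertex
  forced into the same part. It restarts at a root, which keeps nothing, whenever it gets stuck. The component
  explored from a root consists of vertices none of which can keep an arc for free: in every labelling,
  following arcs inside the same part must end, by acyclicity, at a vertex that loses one arc more than the
  bound above. So the roots are paid for as well.
\<close>

section \<open>Funnels and vertex labellings\<close>

lemma pcas_append: "pcas u (p @ q) v \<longleftrightarrow> (\<exists>w. pcas u p w \<and> pcas w q v)"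
  by (induction p arbitrary: u) auto

lemma rtrancl_pcas: "(u, v) \<in> A\<^sup>* \<Longrightarrow> \<exists>p. pcas u p v \<and> set p \<subseteq> A"
proof (induction rule: converse_rtrancl_induct)
  case base
  show ?case by (rule exI[of _ "[]"]) simp
next
  case (step y z)
  then obtain p where "pcas z p v" "set p \<subseteq> A" by blast
  with step(1) show ?case by (intro exI[of _ "(y, z) # p"]) simp
qed

lemma pawalk_verts_reachable:
  "x \<in> set (pawalk_verts u p) \<Longrightarrow> pcas u p v \<Longrightarrow> set p \<subseteq> A \<Longrightarrow> (u, x) \<in> A\<^sup>*"
proof (induction p arbitrary: u)
  case (Cons a p)
  then show ?case
    by (cases a) (auto intro: converse_rtrancl_into_rtrancl)
qed simp

text \<open>A repeated vertex would lie on a cycle. This supplies the distinctness that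
  \<open>apath\<close> asks for, so walks may be spliced freely below.\<close>

lemma acyclic_distinct_pawalk_verts:
  "acyclic A \<Longrightarrow> pcas u p v \<Longrightarrow> set p \<subseteq> A \<Longrightarrow> distinct (pawalk_verts u p)"
proof (induction p arbitrary: u)
  case (Cons a p)
  obtain w where a: "a = (u, w)" "(u, w) \<in> A" "pcas w p v" using Cons.prems by (cases a) auto
  have "u \<notin> set (pawalk_verts w p)"
  proof
    assume "u \<in> set (pawalk_verts w p)"
    then have "(w, u) \<in> A\<^sup>*" using pawalk_verts_reachable[of u w p v A] a Cons.prems by simp
    with a(2) have "(u, u) \<in> A\<^sup>+" by (rule rtrancl_into_trancl2)
    with Cons.prems(1) show False by (auto simp: acyclic_def)
  qed
  with Cons a show ?case by simp
qed simp

section \<open>Source-to-sink paths in terms of the arc set\<close>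

definition no_in :: "('v \<times> 'v) set \<Rightarrow> 'v \<Rightarrow> bool" where
  "no_in A v \<longleftrightarrow> (\<forall>u. (u, v) \<notin> A)"

definition no_out :: "('v \<times> 'v) set \<Rightarrow> 'v \<Rightarrow> bool" where
  "no_out A v \<longleftrightarrow> (\<forall>u. (v, u) \<notin> A)"

text \<open>Refers to the arc set alone. A nonempty walk in a DAG stays among the vertices and
  repeats none of them, so this agrees with \<open>source_sink_path\<close>.\<close>

definition full_walk :: "('v \<times> 'v) set \<Rightarrow> ('v \<times> 'v) list \<Rightarrow> bool" where
  "full_walk A p \<longleftrightarrow> p \<noteq> [] \<and> set p \<subseteq> A \<and> (\<exists>u v. no_in A u \<and> no_out A v \<and> pcas u p v)"

lemma source_sink_path_iff:
  assumes "dag D"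
  shows "source_sink_path D p \<longleftrightarrow> full_walk (parcs D) p"
proof -
  interpret pair_fin_digraph D using assms by (simp add: dag_def)
  have src: "is_source D v \<longleftrightarrow> v \<in> pverts D \<and> no_in (parcs D) v" for v
    using finite_in_arcs[of v] by (auto simp: is_source_def in_degree_def no_in_def in_arcs_def)
  have snk: "is_sink D v \<longleftrightarrow> v \<in> pverts D \<and> no_out (parcs D) v" for v
    using finite_out_arcs[of v] by (auto simp: is_sink_def out_degree_def no_out_def out_arcs_def)
  have V: "u \<in> pverts D \<and> v \<in> pverts D" if "pcas u p v" "set p \<subseteq> parcs D" "p \<noteq> []" for u v
  proof -
    have "awalk u p v"
      using that by (cases p) (auto simp: awalk_def dest: arc_fst_in_verts)
    then show ?thesis using awalk_hd_in_verts awalk_last_in_verts by blast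
  qed
  have "distinct (pawalk_verts u p)" if "pcas u p v" "set p \<subseteq> parcs D" for u v
    using acyclic_distinct_pawalk_verts that assms by (auto simp: dag_def)
  then show ?thesis
    unfolding source_sink_path_def full_walk_def src snk apath_def awalk_def
    using V by blast
qed

section \<open>From labellings to funnels\<close>

definition funnel_labelling :: "('v \<times> 'v) set \<Rightarrow> 'v set \<Rightarrow> bool" where
  "funnel_labelling A F \<longleftrightarrow>
     (\<forall>u v. (u, v) \<in> A \<longrightarrow> v \<in> F \<longrightarrow> u \<in> F) \<and>
     (\<forall>u u' v. v \<in> F \<longrightarrow> (u, v) \<in> A \<longrightarrow> (u', v) \<in> A \<longrightarrow> u = u') \<and>
     (\<forall>u u' v. v \<notin> F \<longrightarrow> (v, u) \<in> A \<longrightarrow> (v, u') \<in> A \<longrightarrow> u = u')"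

lemma pcas_snoc: "pcas u (p @ [a]) v \<longleftrightarrow> pcas u p (fst a) \<and> snd a = v"
  by (auto simp: pcas_append)

text \<open>Going backwards from a vertex of \<open>F\<close>, the only in-arc is forced and its
  tail lies in \<open>F\<close> again, so the walk back to a source has no choice. The alternative
  \<open>no_in A v\<close> covers a walk that has already arrived at its source.\<close>

lemma funnel_labelling_unique_prefix:
  assumes L: "funnel_labelling A F"
  shows "v \<in> F \<or> no_in A v \<Longrightarrow> pcas u p v \<Longrightarrow> pcas u' q v \<Longrightarrow> set p \<subseteq> A \<Longrightarrow> set q \<subseteq> A \<Longrightarrow>
    no_in A u \<Longrightarrow> no_in A u' \<Longrightarrow> p = q"
proof (induction p arbitrary: v q rule: rev_induct)
  case Nil
  then show ?case by (cases q rule: rev_cases) (auto simp: pcas_snoc no_in_def)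
next
  case (snoc a p)
  then obtain q' b where q: "q = q' @ [b]"
    by (cases q rule: rev_cases; cases a) (auto simp: pcas_snoc no_in_def)
  obtain x y where ab: "a = (x, v)" "b = (y, v)" "(x, v) \<in> A" "(y, v) \<in> A"
    using snoc.prems by (cases a, cases b) (auto simp: q pcas_snoc)
  then have "v \<in> F" using snoc.prems(1) by (auto simp: no_in_def)
  with L ab have "x = y" "x \<in> F" by (auto simp: funnel_labelling_def)
  with snoc.IH[of x q'] snoc.prems q ab show ?case by (auto simp: pcas_snoc)
qed

text \<open>Outside \<open>F\<close> the only out-arc is forced, and its head lies outside
  \<open>F\<close> again because \<open>F\<close> is closed under predecessors.\<close>

lemma funnel_labelling_unique_suffix:
  assumes L: "funnel_labelling A F"
  shows "v \<notin> F \<or> no_out A v \<Longrightarrow> pcas v p u \<Longrightarrow> pcas v q u' \<Longrightarrow> set p \<subseteq> A \<Longrightarrow> set q \<subseteq> A \<Longrightarrow>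
    no_out A u \<Longrightarrow> no_out A u' \<Longrightarrow> p = q"
proof (induction p arbitrary: v q)
  case Nil
  then show ?case by (cases q) (auto simp: no_out_def)
next
  case (Cons a p)
  then obtain q' b where q: "q = b # q'"
    by (cases q; cases a) (auto simp: no_out_def)
  obtain x y where ab: "a = (v, x)" "b = (v, y)" "(v, x) \<in> A" "(v, y) \<in> A"
    using Cons.prems by (cases a, cases b) (auto simp: q)
  then have "v \<notin> F" using Cons.prems(1) by (auto simp: no_out_def)
  with L ab have "x = y" "x \<notin> F" by (auto simp: funnel_labelling_def)
  with Cons.IH[of x q'] Cons.prems q ab show ?case by auto
qed

text \<open>The arc sought is the first one whose head lies outside \<open>F\<close> or is a sink.
  All heads before it lie in \<open>F\<close>, so its tail lies in \<open>F\<close> or is the start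
  of the walk.\<close>

lemma crossing_arc:
  assumes "pcas u p t" "p \<noteq> []" "u \<in> F \<or> no_in A u" "no_out A t"
  shows "\<exists>p1 a p2. p = p1 @ a # p2 \<and> (fst a \<in> F \<or> no_in A (fst a)) \<and> (snd a \<notin> F \<or> no_out A (snd a))"
  using assms
proof (induction p arbitrary: u)
  case (Cons a p)
  show ?case
  proof (cases "snd a \<notin> F \<or> no_out A (snd a)")
    case True
    with Cons.prems show ?thesis by (intro exI[of _ "[]"] exI[of _ a] exI[of _ p]) auto
  next
    case False
    with Cons.prems have "p \<noteq> []" by auto
    have "\<exists>p1 b p2. p = p1 @ b # p2 \<and> (fst b \<in> F \<or> no_in A (fst b)) \<and> (snd b \<notin> F \<or> no_out A (snd b))"
      by (rule Cons.IH[of "snd a"]) (use Cons.prems False \<open>p \<noteq> []\<close> in auto)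
    then obtain p1 b p2 where
      "p = p1 @ b # p2" "(fst b \<in> F \<or> no_in A (fst b)) \<and> (snd b \<notin> F \<or> no_out A (snd b))"
      by blast
    then show ?thesis by (intro exI[of _ "a # p1"] exI[of _ b] exI[of _ p2]) simp
  qed
qed simp

text \<open>The crossing arc of a path is private: the part before it is the only walk from a source
  to its tail, the part after it the only walk from its head to a sink.\<close>

lemma funnel_if_labelling:
  assumes D: "dag D" and L: "funnel_labelling (parcs D) F"
  shows "funnel D"
  unfolding funnel_def
proof (intro conjI allI impI D)
  let ?A = "parcs D"
  fix p assume "source_sink_path D p"
  then have p: "full_walk ?A p" by (simp add: source_sink_path_iff D)
  then obtain u v where uv: "p \<noteq> []" "set p \<subseteq> ?A" "no_in ?A u" "no_out ?A v" "pcas u p v"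
    by (auto simp: full_walk_def)
  obtain p1 a p2 where pa: "p = p1 @ a # p2" "fst a \<in> F \<or> no_in ?A (fst a)"
    "snd a \<notin> F \<or> no_out ?A (snd a)" using crossing_arc[of u p v F ?A] uv by blast
  have unique: "q = p" if "full_walk ?A q" "a \<in> set q" for q
  proof -
    from that(1) obtain u' v' where q: "set q \<subseteq> ?A" "no_in ?A u'" "no_out ?A v'" "pcas u' q v'"
      by (auto simp: full_walk_def)
    from that(2) obtain q1 q2 where qa: "q = q1 @ a # q2" by (auto dest: split_list)
    have "p1 = q1"
      by (rule funnel_labelling_unique_prefix[OF L pa(2), of u _ u'])
        (use uv pa(1) q qa in \<open>auto simp: pcas_append\<close>)
    moreover have "p2 = q2"
      by (rule funnel_labelling_unique_suffix[OF L pa(3), of _ v _ v'])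
        (use uv pa(1) q qa in \<open>auto simp: pcas_append\<close>)
    ultimately show ?thesis using pa qa by simp
  qed
  have "a \<in> parcs D" "a \<in> set p" using pa(1) uv(2) by auto
  with p unique have "private_arc D a"
    unfolding private_arc_def source_sink_path_iff[OF D] by blast
  then show "\<exists>a\<in>set p. private_arc D a" using pa(1) by auto
qed

section \<open>From funnels to labellings\<close>

lemma dag_wf:
  assumes "dag D"
  shows "wf (parcs D)" "wf ((parcs D)\<inverse>)"
proof -
  interpret pair_fin_digraph D using assms by (simp add: dag_def)
  have "finite (parcs D)" "acyclic (parcs D)" using assms pair_finite_arcs by (auto simp: dag_def)
  then show "wf (parcs D)" "wf ((parcs D)\<inverse>)"
    using finite_acyclic_wf finite_acyclic_wf_converse by metis+
qed

lemma wf_walk_from_source: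
  assumes "wf A"
  shows "\<exists>u p. no_in A u \<and> set p \<subseteq> A \<and> pcas u p v"
  using assms
proof (induction v rule: wf_induct_rule)
  case (less v)
  show ?case
  proof (cases "no_in A v")
    case True
    then show ?thesis by (intro exI[of _ v] exI[of _ "[]"]) simp
  next
    case False
    then obtain x where x: "(x, v) \<in> A" by (auto simp: no_in_def)
    with less obtain u p where "no_in A u" "set p \<subseteq> A" "pcas u p x" by blast
    with x show ?thesis by (intro exI[of _ u] exI[of _ "p @ [(x, v)]"]) (simp add: pcas_snoc)
  qed
qed

lemma wf_walk_to_sink:
  assumes "wf (A\<inverse>)"
  shows "\<exists>u p. no_out A u \<and> set p \<subseteq> A \<and> pcas v p u"
  using assms
proof (induction v rule: wf_induct_rule)
  case (less v)
  show ?case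
  proof (cases "no_out A v")
    case True
    then show ?thesis by (intro exI[of _ v] exI[of _ "[]"]) simp
  next
    case False
    then obtain x where x: "(v, x) \<in> A" by (auto simp: no_out_def)
    with less obtain u p where "no_out A u" "set p \<subseteq> A" "pcas x p u" by blast
    with x show ?thesis by (intro exI[of _ u] exI[of _ "(v, x) # p"]) simp
  qed
qed

text \<open>
  A walk from a vertex with two in-arcs to a vertex with two out-arcs extends to a source-to-sink
  path each arc of which also lies on a second such path, obtained by changing the part before or
  the part after the walk.
\<close>

lemma funnel_no_merge_before_fork:
  assumes f: "funnel D" and "(x, u) \<in> parcs D" "(x', u) \<in> parcs D" "x \<noteq> x'"
    and "(u, v) \<in> (parcs D)\<^sup>*" and "(v, y) \<in> parcs D" "(v, y') \<in> parcs D" "y \<noteq> y'"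
  shows False
proof -
  let ?A = "parcs D"
  have D: "dag D" using f by (simp add: funnel_def)
  note wf = dag_wf[OF D]
  obtain s p where s: "no_in ?A s" "set p \<subseteq> ?A" "pcas s p x" using wf_walk_from_source[OF wf(1)] by blast
  obtain s' p' where s': "no_in ?A s'" "set p' \<subseteq> ?A" "pcas s' p' x'"
    using wf_walk_from_source[OF wf(1)] by blast
  obtain t q where t: "no_out ?A t" "set q \<subseteq> ?A" "pcas y q t" using wf_walk_to_sink[OF wf(2)] by blast
  obtain t' q' where t': "no_out ?A t'" "set q' \<subseteq> ?A" "pcas y' q' t'"
    using wf_walk_to_sink[OF wf(2)] by blast
  obtain r where r: "pcas u r v" "set r \<subseteq> ?A" using rtrancl_pcas assms(5) by metis
  define P where "P = p @ [(x, u)]"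
  define P' where "P' = p' @ [(x', u)]"
  define Q where "Q = (v, y) # q"
  define Q' where "Q' = (v, y') # q'"
  have ne: "P \<noteq> P'" "Q \<noteq> Q'" using assms by (auto simp: P_def P'_def Q_def Q'_def)
  have walks: "full_walk ?A (X @ r @ Y)"
    if "X \<noteq> []" "set X \<subseteq> ?A" "set Y \<subseteq> ?A" "pcas a X u" "pcas v Y b" "no_in ?A a" "no_out ?A b" for X Y a b
  proof -
    have "pcas a (X @ r @ Y) b" using that(4,5) r(1) pcas_append by metis
    then show ?thesis unfolding full_walk_def using that r(2) by auto
  qed
  have w: "full_walk ?A (P @ r @ Q)"
    by (rule walks[of _ _ s t]) (use assms s t in \<open>auto simp: P_def Q_def pcas_snoc\<close>)
  have w1: "full_walk ?A (P' @ r @ Q)"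
    by (rule walks[of _ _ s' t]) (use assms s' t in \<open>auto simp: P'_def Q_def pcas_snoc\<close>)
  have w2: "full_walk ?A (P @ r @ Q')"
    by (rule walks[of _ _ s t']) (use assms s t' in \<open>auto simp: P_def Q'_def pcas_snoc\<close>)
  from f w obtain a where a: "a \<in> set (P @ r @ Q)" "private_arc D a"
    by (auto simp: funnel_def source_sink_path_iff D)
  then have unique: "q1 = q2" if "full_walk ?A q1" "full_walk ?A q2" "a \<in> set q1" "a \<in> set q2" for q1 q2
    using that by (auto simp: private_arc_def source_sink_path_iff D)
  show False
  proof (cases "a \<in> set (r @ Q)")
    case True
    then show False using unique[OF w w1] ne by simp
  next
    case False
    then have "a \<in> set P" using a(1) by simp
    then show False using unique[OF w w2] ne by simp
  qed
qed

text \<open>Take for \<open>F\<close> the vertices that no vertex with two in-arcs reaches. A vertex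
  outside \<open>F\<close> with two out-arcs would be a fork behind a merge, which
  \<open>funnel_no_merge_before_fork\<close> excludes.\<close>

lemma funnel_labelling_exists:
  assumes f: "funnel D"
  shows "\<exists>F. funnel_labelling (parcs D) F"
proof -
  let ?A = "parcs D"
  let ?F = "{v. \<forall>u x x'. (u, v) \<in> ?A\<^sup>* \<longrightarrow> (x, u) \<in> ?A \<longrightarrow> (x', u) \<in> ?A \<longrightarrow> x = x'}"
  have "funnel_labelling ?A ?F"
    unfolding funnel_labelling_def
  proof (intro conjI allI impI)
    fix u u' v assume "v \<notin> ?F" "(v, u) \<in> ?A" "(v, u') \<in> ?A"
    then show "u = u'" using funnel_no_merge_before_fork[OF f] by blast
  qed (auto intro: rtrancl_into_rtrancl)
  then show ?thesis by blast
qed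

section \<open>Greedy deletion along a search forest\<close>

text \<open>For \<open>f\<close> the head or tail function this is the in- or out-degree of
  \<open>v\<close> among the first \<open>k\<close> arcs. The bound \<open>k\<close> allows it to
  describe the degree arrays while the arcs are being counted.\<close>

definition occurrences :: "(nat \<Rightarrow> nat) \<Rightarrow> nat \<Rightarrow> nat \<Rightarrow> nat" where
  "occurrences f k v = card {j. j < k \<and> f j = v}"

lemma occurrences_0: "occurrences f 0 = (\<lambda>_. 0)"
  by (simp add: occurrences_def fun_eq_iff)

lemma occurrences_Suc: "occurrences f (Suc k) = (occurrences f k)(f k := Suc (occurrences f k (f k)))"
proof
  fix v
  have "{j. j < Suc k \<and> f j = v} = (if f k = v then insert k {j. j < k \<and> f j = v} else {j. j < k \<and> f j = v})"
    by (auto simp: less_Suc_eq)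
  then show "occurrences f (Suc k) v = ((occurrences f k)(f k := Suc (occurrences f k (f k)))) v"
    by (auto simp: occurrences_def)
qed

lemma occurrences_le: "occurrences f k v \<le> k"
  by (induction k arbitrary: v) (auto simp: occurrences_0 occurrences_Suc le_SucI)

lemma occurrences_pos_iff: "0 < occurrences f k v \<longleftrightarrow> (\<exists>j<k. f j = v)"
  by (auto simp: occurrences_def card_gt_0_iff)

lemma sum_occurrences: "(\<And>j. j < k \<Longrightarrow> f j < n) \<Longrightarrow> (\<Sum>v<n. occurrences f k v) = k"
proof (induction k)
  case (Suc k)
  have "(\<Sum>v<n. occurrences f (Suc k) v) = (\<Sum>v<n. occurrences f k v + (if v = f k then 1 else 0))"
    by (intro sum.cong) (auto simp: occurrences_Suc)
  with Suc show ?case by (simp add: sum.distrib)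
qed (simp add: occurrences_0)

section \<open>Seeds, eligible arcs and components\<close>

text \<open>Vertices and arcs are indices, as in the arrays of the machine. Acyclicity appears as
  well-foundedness in both directions because \<open>excess_in_component\<close> descends along the
  arcs both ways.\<close>

locale indexed_dag =
  fixes n m :: nat and T H :: "nat \<Rightarrow> nat"
  assumes T_less: "k < m \<Longrightarrow> T k < n"
    and H_less: "k < m \<Longrightarrow> H k < n"
    and wf_arcs: "wf {(T k, H k) | k. k < m}"
    and wf_arcs_converse: "wf ({(T k, H k) | k. k < m}\<inverse>)"
begin

abbreviation indeg :: "nat \<Rightarrow> nat" where "indeg \<equiv> occurrences H m"

abbreviation outdeg :: "nat \<Rightarrow> nat" where "outdeg \<equiv> occurrences T m"

definition seeds :: "nat set" where
  "seeds = {H k | k. k < m \<and> indeg (T k) < outdeg (T k) \<and> indeg (H k) \<le> outdeg (H k)} \<union>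
           {T k | k. k < m \<and> outdeg (H k) < indeg (H k) \<and> outdeg (T k) \<le> indeg (T k)}"

text \<open>The arcs that either end may keep: the tail is free to join \<open>M\<close> and the
  head to join \<open>F\<close>. Once one end is labelled, the other can be labelled for
  free.\<close>

definition eligible :: "(nat \<times> nat) set" where
  "eligible = {(T k, H k) | k. k < m \<and> outdeg (T k) \<le> indeg (T k) \<and> indeg (H k) \<le> outdeg (H k)}"

definition linked :: "(nat \<times> nat) set" where
  "linked = (eligible \<union> eligible\<inverse>)\<^sup>*"

lemma linked_refl: "(v, v) \<in> linked"
  by (simp add: linked_def)

lemma linked_sym: "(u, v) \<in> linked \<Longrightarrow> (v, u) \<in> linked"
  unfolding linked_def
  by (metis converse_Un converse_converse rtrancl_converseI sup_commute)

lemma linked_trans: "(u, v) \<in> linked \<Longrightarrow> (v, w) \<in> linked \<Longrightarrow> (u, w) \<in> linked"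
  unfolding linked_def by (rule rtrancl_trans)

lemma linked_closed:
  assumes "(u, v) \<in> linked" "u \<in> S" "\<And>x y. x \<in> S \<Longrightarrow> (x, y) \<in> eligible \<or> (y, x) \<in> eligible \<Longrightarrow> y \<in> S"
  shows "v \<in> S"
  using assms(1,2) unfolding linked_def
  by (induction rule: rtrancl_induct) (use assms(3) in auto)

text \<open>
  In a labelling that witnesses a funnel, a vertex \<open>v\<close> loses at least \<open>min (indeg v) (outdeg v) - 1\<close>
  of the arcs on its own side, and one more if it is in excess.
\<close>

definition excess :: "nat set \<Rightarrow> nat set" where
  "excess F = {v. v < n \<and> 0 < indeg v \<and> 0 < outdeg v \<and>
     \<not> (if v \<in> F then indeg v \<le> outdeg v \<and> (\<exists>k<m. H k = v \<and> T k \<in> F)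
        else outdeg v \<le> indeg v \<and> (\<exists>k<m. T k = v \<and> H k \<notin> F))}"

text \<open>Suppose the component \<open>C\<close> of \<open>r\<close> avoids the excess. A vertex
  of \<open>C\<close> in \<open>F\<close> has an in-arc from \<open>F\<close>; as it is no seed, the
  tail is not forced into \<open>F\<close>, so the arc is eligible and the tail lies in
  \<open>C\<close> too. Well-foundedness then empties \<open>C\<close> of \<open>F\<close>, and
  dually of its complement, although \<open>r\<close> is in \<open>C\<close>.\<close>

lemma excess_in_component:
  assumes r: "r < n" "0 < indeg r" "0 < outdeg r" and ns: "\<And>s. s \<in> seeds \<Longrightarrow> (s, r) \<notin> linked"
  shows "\<exists>v \<in> excess F. (r, v) \<in> linked"
proof (rule ccontr)
  assume no: "\<not> ?thesis"
  define C where "C = {v. (r, v) \<in> linked}"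
  \<comment> \<open>An end of an eligible arc has positive degree on the side of that arc, and the
    other degree is at least as large. So positivity of both degrees spreads over the
    component.\<close>
  have C_pos: "v < n \<and> 0 < indeg v \<and> 0 < outdeg v" if "v \<in> C" for v
  proof -
    have "v \<in> {v. v < n \<and> 0 < indeg v \<and> 0 < outdeg v}"
    proof (rule linked_closed)
      show "(r, v) \<in> linked" using that by (simp add: C_def)
      fix x y assume "x \<in> {v. v < n \<and> 0 < indeg v \<and> 0 < outdeg v}" "(x, y) \<in> eligible \<or> (y, x) \<in> eligible"
      then show "y \<in> {v. v < n \<and> 0 < indeg v \<and> 0 < outdeg v}"
      proof (elim disjE)
        assume "(x, y) \<in> eligible"
        then obtain k where k: "k < m" "y = H k" "indeg y \<le> outdeg y" by (auto simp: eligible_def)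
        then have "0 < indeg y" by (auto simp: occurrences_pos_iff)
        with k H_less show ?thesis by auto
      next
        assume "(y, x) \<in> eligible"
        then obtain k where k: "k < m" "y = T k" "outdeg y \<le> indeg y" by (auto simp: eligible_def)
        then have "0 < outdeg y" by (auto simp: occurrences_pos_iff)
        with k T_less show ?thesis by auto
      qed
    qed (use r in simp)
    then show ?thesis by simp
  qed
  have C_noseed: "v \<notin> seeds" if "v \<in> C" for v
    using that ns linked_sym by (auto simp: C_def)
  have C_step: "y \<in> C" if "x \<in> C" "(x, y) \<in> eligible \<or> (y, x) \<in> eligible" for x y
    using that by (auto simp: C_def linked_def intro: rtrancl_into_rtrancl)
  have happy: "if v \<in> F then indeg v \<le> outdeg v \<and> (\<exists>k<m. H k = v \<and> T k \<in> F)
        else outdeg v \<le> indeg v \<and> (\<exists>k<m. T k = v \<and> H k \<notin> F)" if "v \<in> C" for v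
    using no that C_pos[OF that] unfolding excess_def C_def by blast
  have "v \<in> C \<longrightarrow> v \<notin> F" for v
    using wf_arcs
  proof (induction v rule: wf_induct_rule)
    case (less v)
    show ?case
    proof (intro impI notI)
      assume v: "v \<in> C" "v \<in> F"
      then obtain k where k: "k < m" "H k = v" "T k \<in> F" "indeg v \<le> outdeg v"
        using happy[of v] by auto
      with C_noseed[OF v(1)] have "outdeg (T k) \<le> indeg (T k)"
        by (auto simp: seeds_def not_less[symmetric])
      then have "(T k, v) \<in> eligible" using k by (auto simp: eligible_def)
      with v have "T k \<in> C" by (auto intro: C_step)
      with less k show False by auto
    qed
  qed
  moreover have "v \<in> C \<longrightarrow> v \<in> F" for v
    using wf_arcs_converse
  proof (induction v rule: wf_induct_rule)
    case (less v)
    show ?case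
    proof (intro impI, rule ccontr)
      assume v: "v \<in> C" "v \<notin> F"
      then obtain k where k: "k < m" "T k = v" "H k \<notin> F" "outdeg v \<le> indeg v"
        using happy[of v] by auto
      with C_noseed[OF v(1)] have "indeg (H k) \<le> outdeg (H k)"
        by (auto simp: seeds_def not_less[symmetric])
      then have "(v, H k) \<in> eligible" using k by (auto simp: eligible_def)
      with v have "H k \<in> C" by (auto intro: C_step)
      with less k show False by auto
    qed
  qed
  ultimately show False using linked_refl[of r] by (auto simp: C_def)
qed

text \<open>The roots lie in distinct components, and each of these contains an excess vertex.
  Choosing one for every root gives an injection.\<close>

lemma card_roots_le_excess:
  assumes "\<And>r. r \<in> R \<Longrightarrow> r < n \<and> 0 < indeg r \<and> 0 < outdeg r \<and> (\<forall>s \<in> seeds. (s, r) \<notin> linked)"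
    and "\<And>r r'. r \<in> R \<Longrightarrow> r' \<in> R \<Longrightarrow> (r, r') \<in> linked \<Longrightarrow> r = r'"
  shows "card R \<le> card (excess F)"
proof -
  have "\<forall>r \<in> R. \<exists>v. v \<in> excess F \<and> (r, v) \<in> linked"
    using excess_in_component assms(1) by meson
  then obtain f where f: "\<And>r. r \<in> R \<Longrightarrow> f r \<in> excess F \<and> (r, f r) \<in> linked" by metis
  have "inj_on f R"
  proof
    fix r r' assume "r \<in> R" "r' \<in> R" "f r = f r'"
    then have "(r, r') \<in> linked" using f linked_sym linked_trans by metis
    then show "r = r'" using assms(2) \<open>r \<in> R\<close> \<open>r' \<in> R\<close> by blast
  qed
  moreover have "finite (excess F)" by (rule finite_subset[of _ "{..<n}"]) (auto simp: excess_def)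
  ultimately show ?thesis using f by (intro card_inj_on_le[of f]) auto
qed

section \<open>Lower bound for every deletion set\<close>

text \<open>\<open>K\<close> holds the surviving arcs of any deletion that leaves a funnel labelled
  by \<open>F\<close>. The deleted arcs on the side of \<open>v\<close>, counted by
  \<open>d v\<close>, are summed over all \<open>v\<close>.\<close>

lemma deletions_lower_bound:
  assumes K: "K \<subseteq> {..<m}"
    and F1: "\<And>k. k \<in> K \<Longrightarrow> H k \<in> F \<Longrightarrow> T k \<in> F"
    and F2: "\<And>j k. j \<in> K \<Longrightarrow> k \<in> K \<Longrightarrow> H j = H k \<Longrightarrow> H j \<in> F \<Longrightarrow> j = k"
    and F3: "\<And>j k. j \<in> K \<Longrightarrow> k \<in> K \<Longrightarrow> T j = T k \<Longrightarrow> T j \<notin> F \<Longrightarrow> j = k"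
  shows "(\<Sum>v<n. min (indeg v) (outdeg v) - 1) + card (excess F) \<le> 2 * card ({..<m} - K)"
proof -
  let ?X = "{..<m} - K"
  define d where "d v = (if v \<in> F then card {k \<in> ?X. H k = v} else card {k \<in> ?X. T k = v})" for v
  have split: "occurrences f m v = card {k \<in> ?X. f k = v} + card {k \<in> K. f k = v}" for f v
  proof -
    have "{j. j < m \<and> f j = v} = {k \<in> ?X. f k = v} \<union> {k \<in> K. f k = v}" using K by auto
    then show ?thesis unfolding occurrences_def
      by (simp add: card_Un_disjoint finite_subset[OF K] disjoint_iff)
  qed
  have one: "card S \<le> 1" if "\<And>j k. j \<in> S \<Longrightarrow> k \<in> S \<Longrightarrow> j = k" for S :: "nat set"
    using that by (metis One_nat_def card_le_Suc0_iff_eq card.infinite le0)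
  \<comment> \<open>At most one arc on the side of \<open>v\<close> survives. A vertex in excess
    loses one more: either its side is the larger one, or no arc on its side joins it to a vertex of
    its own part, and then none survives.\<close>
  have d: "min (indeg v) (outdeg v) - 1 + (if v \<in> excess F then 1 else 0) \<le> d v" if "v < n" for v
  proof (cases "v \<in> F")
    case True
    have "card {k \<in> K. H k = v} \<le> 1" using F2 True by (intro one) auto
    moreover have "card {k \<in> K. H k = v} = 0" if "\<not> (\<exists>k<m. H k = v \<and> T k \<in> F)"
    proof -
      have "{k \<in> K. H k = v} = {}" using that K F1 True by auto
      then show ?thesis by (simp only: card.empty)
    qed
    ultimately show ?thesis using split[of H v] True unfolding d_def excess_def
      by (auto split: if_splits)
  next
    case False
    have "card {k \<in> K. T k = v} \<le> 1" using F3 False by (intro one) auto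
    moreover have "card {k \<in> K. T k = v} = 0" if "\<not> (\<exists>k<m. T k = v \<and> H k \<notin> F)"
    proof -
      have "{k \<in> K. T k = v} = {}" using that K F1 False by auto
      then show ?thesis by (simp only: card.empty)
    qed
    ultimately show ?thesis using split[of T v] False unfolding d_def excess_def
      by (auto split: if_splits)
  qed
  have "(\<Sum>v<n. min (indeg v) (outdeg v) - 1) + card (excess F)
      = (\<Sum>v<n. min (indeg v) (outdeg v) - 1 + (if v \<in> excess F then 1 else 0))"
  proof -
    have "{v. v < n \<and> v \<in> excess F} = excess F" by (auto simp: excess_def)
    then show ?thesis by (simp add: sum.distrib sum.If_cases Int_def)
  qed
  also have "\<dots> \<le> (\<Sum>v<n. d v)" using d by (intro sum_mono) auto
  \<comment> \<open>A deleted arc is counted at its head only if the head is in \<open>F\<close>,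
    and at its tail only if the tail is not. Hence each of the two sums is at most
    \<open>card ?X\<close>.\<close>
  also have "\<dots> \<le> (\<Sum>v<n. card {k \<in> ?X. H k = v \<and> v \<in> F}) + (\<Sum>v<n. card {k \<in> ?X. T k = v \<and> v \<notin> F})"
    unfolding sum.distrib[symmetric] by (intro sum_mono) (auto simp: d_def)
  also have "(\<Sum>v<n. card {k \<in> ?X. H k = v \<and> v \<in> F}) = card (\<Union>v<n. {k \<in> ?X. H k = v \<and> v \<in> F})"
    by (intro card_UN_disjoint[symmetric]) auto
  also have "\<dots> \<le> card ?X" by (intro card_mono) auto
  also have "(\<Sum>v<n. card {k \<in> ?X. T k = v \<and> v \<notin> F}) = card (\<Union>v<n. {k \<in> ?X. T k = v \<and> v \<notin> F})"
    by (intro card_UN_disjoint[symmetric]) auto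
  also have "\<dots> \<le> card ?X" by (intro card_mono) auto
  finally show ?thesis by simp
qed

text \<open>
  The label 1 stands for the forest part \<open>F\<close> and 2 for its complement, as 0 marks
  vertices not yet labelled; \<open>keep v\<close> is 0 or one more than the index of the kept arc.
\<close>

definition deleted :: "(nat \<Rightarrow> nat) \<Rightarrow> (nat \<Rightarrow> nat) \<Rightarrow> nat \<Rightarrow> bool" where
  "deleted lab keep k \<longleftrightarrow>
     lab (H k) = 1 \<and> keep (H k) \<noteq> Suc k \<or> lab (T k) = 2 \<and> keep (T k) \<noteq> Suc k"

text \<open>The far end of a kept arc must be labelled already or forced into the same part. This
  prevents an end that is labelled later from keeping the same arc from the opposite part.\<close>

definition label_ok :: "(nat \<Rightarrow> nat) \<Rightarrow> (nat \<Rightarrow> nat) \<Rightarrow> nat \<Rightarrow> bool" where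
  "label_ok lab keep v \<longleftrightarrow> v < n \<and>
     (lab v = 1 \<and> indeg v \<le> outdeg v \<and>
        (\<forall>k. keep v = Suc k \<longrightarrow> k < m \<and> H k = v \<and> (lab (T k) \<noteq> 0 \<or> indeg (T k) < outdeg (T k))) \<or>
      lab v = 2 \<and> outdeg v \<le> indeg v \<and>
        (\<forall>k. keep v = Suc k \<longrightarrow> k < m \<and> T k = v \<and> (lab (H k) \<noteq> 0 \<or> outdeg (H k) < indeg (H k))))"

text \<open>The second clause rules out the arcs from \<open>M\<close> to \<open>F\<close> that
  would survive. The third is what \<open>card_roots_le_excess\<close> demands of the roots,
  recognised by \<open>keep r = 0\<close>.\<close>

definition sound :: "(nat \<Rightarrow> nat) \<Rightarrow> (nat \<Rightarrow> nat) \<Rightarrow> bool" where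
  "sound lab keep \<longleftrightarrow>
     (\<forall>v. lab v \<noteq> 0 \<longrightarrow> label_ok lab keep v) \<and>
     (\<forall>k<m. \<not> (lab (T k) = 2 \<and> lab (H k) = 1 \<and> keep (T k) = Suc k \<and> keep (H k) = Suc k)) \<and>
     (\<forall>r. lab r \<noteq> 0 \<longrightarrow> keep r = 0 \<longrightarrow> (\<forall>s \<in> seeds. (s, r) \<notin> linked) \<and>
        (\<forall>r'. lab r' \<noteq> 0 \<longrightarrow> keep r' = 0 \<longrightarrow> (r, r') \<in> linked \<longrightarrow> r = r'))"

section \<open>Deletions made by a sound labelling\<close>

lemma label_ok_mono:
  assumes "label_ok lab keep v" "lab' v = lab v" "keep' v = keep v" "\<And>x. lab x \<noteq> 0 \<Longrightarrow> lab' x \<noteq> 0"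
  shows "label_ok lab' keep' v"
  using assms unfolding label_ok_def by metis

lemma label_ok_head:
  assumes "label_ok lab keep v" "lab v = 1" "keep v = Suc k"
  shows "k < m \<and> H k = v \<and> (lab (T k) \<noteq> 0 \<or> indeg (T k) < outdeg (T k))"
proof -
  have "lab v \<noteq> 2" using assms(2) by simp
  with assms show ?thesis unfolding label_ok_def by blast
qed

lemma label_ok_tail:
  assumes "label_ok lab keep v" "lab v = 2" "keep v = Suc k"
  shows "k < m \<and> T k = v \<and> (lab (H k) \<noteq> 0 \<or> outdeg (H k) < indeg (H k))"
proof -
  have "lab v \<noteq> 1" using assms(2) by simp
  with assms show ?thesis unfolding label_ok_def by blast
qed

lemma sound_label_ok: "sound lab keep \<Longrightarrow> lab v \<noteq> 0 \<Longrightarrow> label_ok lab keep v"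
  by (simp add: sound_def)

lemma sound_not_mutual:
  "sound lab keep \<Longrightarrow> k < m \<Longrightarrow> lab (T k) = 2 \<Longrightarrow> lab (H k) = 1 \<Longrightarrow> keep (T k) = Suc k \<Longrightarrow>
    keep (H k) \<noteq> Suc k"
  by (simp add: sound_def)

lemma sound_root_not_seed:
  "sound lab keep \<Longrightarrow> lab r \<noteq> 0 \<Longrightarrow> keep r = 0 \<Longrightarrow> s \<in> seeds \<Longrightarrow> (s, r) \<notin> linked"
  by (simp add: sound_def)

lemma sound_roots_not_linked:
  "sound lab keep \<Longrightarrow> lab r \<noteq> 0 \<Longrightarrow> keep r = 0 \<Longrightarrow> lab r' \<noteq> 0 \<Longrightarrow> keep r' = 0 \<Longrightarrow>
    (r, r') \<in> linked \<Longrightarrow> r = r'"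
  by (simp add: sound_def)

lemma soundI:
  assumes "\<And>v. lab v \<noteq> 0 \<Longrightarrow> label_ok lab keep v"
    and "\<And>k. k < m \<Longrightarrow> lab (T k) = 2 \<Longrightarrow> lab (H k) = 1 \<Longrightarrow> keep (T k) = Suc k \<Longrightarrow> keep (H k) \<noteq> Suc k"
    and "\<And>r s. lab r \<noteq> 0 \<Longrightarrow> keep r = 0 \<Longrightarrow> s \<in> seeds \<Longrightarrow> (s, r) \<notin> linked"
    and "\<And>r r'. lab r \<noteq> 0 \<Longrightarrow> keep r = 0 \<Longrightarrow> lab r' \<noteq> 0 \<Longrightarrow> keep r' = 0 \<Longrightarrow>
      (r, r') \<in> linked \<Longrightarrow> r = r'"
  shows "sound lab keep"
  unfolding sound_def using assms by blast

text \<open>A vertex that keeps an arc deletes one less than its smaller degree, a root one arc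
  more. The roots are charged to the excess of an arbitrary \<open>F\<close>, so the bound can be
  compared with any deletion set.\<close>

lemma deletions_upper_bound:
  assumes s: "sound lab keep" and all: "\<And>v. v < n \<Longrightarrow> lab v \<noteq> 0"
  shows "card {k. k < m \<and> deleted lab keep k} \<le> (\<Sum>v<n. min (indeg v) (outdeg v) - 1) + card (excess F)"
proof -
  \<comment> \<open>A root with a zero degree has no arc on its side and so costs nothing
    extra.\<close>
  define R where "R = {r. r < n \<and> 0 < indeg r \<and> 0 < outdeg r \<and> keep r = 0}"
  define B where "B v = (if lab v = 1 then {k. k < m \<and> H k = v \<and> keep v \<noteq> Suc k}
      else {k. k < m \<and> T k = v \<and> keep v \<noteq> Suc k})" for v
  have R: "card R \<le> card (excess F)"
    using all sound_root_not_seed[OF s] sound_roots_not_linked[OF s]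
    by (intro card_roots_le_excess) (auto simp: R_def)
  have sub: "card ({k. k < m \<and> f k = v \<and> a \<noteq> Suc k}) = occurrences f m v - (if a = 0 then 0 else 1)"
    if "a = 0 \<or> a \<le> m \<and> f (a - 1) = v" for f a v
  proof (cases a)
    case (Suc b)
    have "{k. k < m \<and> f k = v \<and> b \<noteq> k} = {k. k < m \<and> f k = v} - {b}"
      by auto
    moreover have "b \<in> {k. k < m \<and> f k = v}" using that Suc by auto
    ultimately show ?thesis by (simp add: occurrences_def Suc card_Diff_singleton)
  qed (simp add: occurrences_def)
  have B: "card (B v) \<le> min (indeg v) (outdeg v) - 1 + (if v \<in> R then 1 else 0)" if v: "v < n" for v
  proof -
    have l: "lab v = 1 \<and> indeg v \<le> outdeg v \<and> (keep v = 0 \<or> keep v \<le> m \<and> H (keep v - 1) = v) \<or>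
      lab v = 2 \<and> outdeg v \<le> indeg v \<and> (keep v = 0 \<or> keep v \<le> m \<and> T (keep v - 1) = v)"
      using sound_label_ok[OF s all[OF v]] unfolding label_ok_def
      by (metis Suc_le_eq Suc_pred' diff_Suc_1 neq0_conv not0_implies_Suc)
    then show ?thesis
    proof (elim disjE conjE, goal_cases)
      case 1 then show ?case using sub[of "keep v" H v] v by (auto simp: B_def R_def)
    next
      case 2 then show ?case using sub[of "keep v" H v] v by (auto simp: B_def R_def)
    next
      case 3 then show ?case using sub[of "keep v" T v] v by (auto simp: B_def R_def)
    next
      case 4 then show ?case using sub[of "keep v" T v] v by (auto simp: B_def R_def)
    qed
  qed
  have "{k. k < m \<and> deleted lab keep k} \<subseteq> (\<Union>v<n. B v)"
    using T_less H_less by (auto simp: deleted_def B_def)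
  then have "card {k. k < m \<and> deleted lab keep k} \<le> card (\<Union>v<n. B v)"
    by (intro card_mono) (auto simp: B_def)
  also have "\<dots> \<le> (\<Sum>v<n. card (B v))" by (rule card_UN_le) simp
  also have "\<dots> \<le> (\<Sum>v<n. min (indeg v) (outdeg v) - 1 + (if v \<in> R then 1 else 0))"
    using B by (intro sum_mono) auto
  also have "\<dots> = (\<Sum>v<n. min (indeg v) (outdeg v) - 1) + card R"
  proof -
    have "{v. v < n \<and> v \<in> R} = R" by (auto simp: R_def)
    then show ?thesis by (simp add: sum.distrib sum.If_cases Int_def)
  qed
  finally show ?thesis using R by linarith
qed

text \<open>A surviving arc with head in \<open>F\<close> is the one its head keeps, and one with
  tail in \<open>M\<close> the one its tail keeps. By soundness no arc from \<open>M\<close> to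
  \<open>F\<close> is kept by both ends.\<close>

lemma kept_arcs_labelling:
  assumes s: "sound lab keep" and all: "\<forall>v<n. lab v \<noteq> 0"
    and K: "j < m" "k < m" "\<not> deleted lab keep j" "\<not> deleted lab keep k"
  shows "lab (H k) = 1 \<Longrightarrow> lab (T k) = 1"
    and "H j = H k \<Longrightarrow> lab (H j) = 1 \<Longrightarrow> j = k"
    and "T j = T k \<Longrightarrow> lab (T j) \<noteq> 1 \<Longrightarrow> j = k"
proof -
  have l: "lab v = 1 \<or> lab v = 2" if "v < n" for v
    using sound_label_ok[OF s, of v] all that by (auto simp: label_ok_def)
  show "lab (H k) = 1 \<Longrightarrow> lab (T k) = 1"
    using l[OF T_less[OF K(2)]] sound_not_mutual[OF s K(2)] K by (auto simp: deleted_def)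
  show "H j = H k \<Longrightarrow> lab (H j) = 1 \<Longrightarrow> j = k"
    using K by (auto simp: deleted_def)
  show "T j = T k \<Longrightarrow> lab (T j) \<noteq> 1 \<Longrightarrow> j = k"
    using l[OF T_less[OF K(1)]] K by (auto simp: deleted_def)
qed

section \<open>The search queue\<close>

definition queue :: "(nat \<Rightarrow> nat) \<Rightarrow> (nat \<Rightarrow> nat) \<Rightarrow> nat \<Rightarrow> bool" where
  "queue lab q t \<longleftrightarrow> inj_on q {..<t} \<and> q ` {..<t} = {v. lab v \<noteq> 0}"

definition expanded :: "(nat \<Rightarrow> nat) \<Rightarrow> nat \<Rightarrow> bool" where
  "expanded lab u \<longleftrightarrow> (\<forall>v. (u, v) \<in> eligible \<or> (v, u) \<in> eligible \<longrightarrow> lab v \<noteq> 0)"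

lemma expanded_mono: "expanded lab u \<Longrightarrow> (\<And>v. lab v \<noteq> 0 \<Longrightarrow> lab' v \<noteq> 0) \<Longrightarrow> expanded lab' u"
  unfolding expanded_def by blast

lemma sound_init: "sound (\<lambda>_. 0) (\<lambda>_. 0)"
  by (simp add: sound_def)

lemma queue_init: "queue (\<lambda>_. 0) q 0"
  by (simp add: queue_def)

lemma queue_push:
  assumes "queue lab q t" "lab v = 0" "l \<noteq> 0"
  shows "queue (lab(v := l)) (q(t := v)) (Suc t)"
proof -
  have v: "v \<notin> q ` {..<t}" using assms by (auto simp: queue_def)
  have "(q(t := v)) ` {..<t} = q ` {..<t}" by (intro image_cong) auto
  moreover have "inj_on (q(t := v)) {..<t}" using assms(1) by (auto simp: queue_def inj_on_def)
  ultimately show ?thesis using assms v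
    by (auto simp: queue_def lessThan_Suc)
qed

lemma queue_length:
  assumes "queue lab q t"
  shows "t = card {v. lab v \<noteq> 0}"
  using assms card_image[of q "{..<t}"] unfolding queue_def by (metis card_lessThan)

lemma queue_length_le:
  assumes "queue lab q t" "sound lab keep"
  shows "t \<le> n"
proof -
  have "{v. lab v \<noteq> 0} \<subseteq> {..<n}" using sound_label_ok[OF assms(2)] by (auto simp: label_ok_def)
  then have "card {v. lab v \<noteq> 0} \<le> card {..<n}" by (intro card_mono) auto
  then show ?thesis using queue_length[OF assms(1)] by simp
qed

lemma queue_length_less:
  assumes "queue lab q t" "sound lab keep" "lab v = 0" "v < n"
  shows "t < n"
proof -
  have "{v. lab v \<noteq> 0} \<subseteq> {..<n}" using sound_label_ok[OF assms(2)] by (auto simp: label_ok_def)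
  moreover have "v \<in> {..<n} - {v. lab v \<noteq> 0}" using assms(3,4) by simp
  ultimately have "{v. lab v \<noteq> 0} \<subset> {..<n}" by blast
  then have "card {v. lab v \<noteq> 0} < card {..<n}" by (intro psubset_card_mono) auto
  then show ?thesis using queue_length[OF assms(1)] by simp
qed

section \<open>Extending a sound labelling by one vertex\<close>

text \<open>Only mutual keeping needs care. If a tail in \<open>M\<close> keeps an arc whose head is
  still unlabelled, that head is forced into \<open>M\<close> by \<open>label_ok\<close>, so it
  cannot be the vertex now labelled 1. No root is added.\<close>

lemma sound_label_head:
  assumes s: "sound lab keep" and k: "k < m" "lab (H k) = 0" "indeg (H k) \<le> outdeg (H k)"
    and p: "lab (T k) \<noteq> 0 \<or> indeg (T k) < outdeg (T k)"
  shows "sound (lab(H k := 1)) (keep(H k := Suc k))" (is "sound ?lab ?keep")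
proof (rule soundI)
  fix v assume "?lab v \<noteq> 0"
  then show "label_ok ?lab ?keep v"
  proof (cases "v = H k")
    case True
    then show ?thesis using k p H_less[OF k(1)] by (auto simp: label_ok_def)
  next
    case False
    then have "label_ok lab keep v" using sound_label_ok[OF s] \<open>?lab v \<noteq> 0\<close> by simp
    then show ?thesis by (rule label_ok_mono) (use False in simp_all)
  qed
next
  fix j assume j: "j < m" "?lab (T j) = 2" "?lab (H j) = 1" "?keep (T j) = Suc j"
  have T: "T j \<noteq> H k" "lab (T j) = 2" using j(2) by (cases "T j = H k"; simp)+
  then have T3: "keep (T j) = Suc j" using j(4) by simp
  show "?keep (H j) \<noteq> Suc j"
  proof (cases "H j = H k")
    case True
    have "label_ok lab keep (T j)" using sound_label_ok[OF s] T(2) by simp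
    with label_ok_tail[OF this T(2)] show ?thesis using T(1) T3 True k(2,3) by auto
  next
    case False
    then show ?thesis using sound_not_mutual[OF s j(1) T(2)] T3 j(3) by simp
  qed
next
  fix r s assume "?lab r \<noteq> 0" "?keep r = 0" "s \<in> seeds"
  moreover from this have "r \<noteq> H k" by auto
  ultimately show "(s, r) \<notin> linked" using sound_root_not_seed[OF s, of r s] by simp
next
  fix r r' assume "?lab r \<noteq> 0" "?keep r = 0" "?lab r' \<noteq> 0" "?keep r' = 0" "(r, r') \<in> linked"
  moreover from this have "r \<noteq> H k" "r' \<noteq> H k" by auto
  ultimately show "r = r'" using sound_roots_not_linked[OF s, of r r'] by simp
qed

text \<open>The argument for \<open>sound_label_head\<close> with tails and heads exchanged.\<close>

lemma sound_label_tail: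
  assumes s: "sound lab keep" and k: "k < m" "lab (T k) = 0" "outdeg (T k) \<le> indeg (T k)"
    and p: "lab (H k) \<noteq> 0 \<or> outdeg (H k) < indeg (H k)"
  shows "sound (lab(T k := 2)) (keep(T k := Suc k))" (is "sound ?lab ?keep")
proof (rule soundI)
  fix v assume "?lab v \<noteq> 0"
  then show "label_ok ?lab ?keep v"
  proof (cases "v = T k")
    case True
    then show ?thesis using k p T_less[OF k(1)] by (auto simp: label_ok_def)
  next
    case False
    then have "label_ok lab keep v" using sound_label_ok[OF s] \<open>?lab v \<noteq> 0\<close> by simp
    then show ?thesis by (rule label_ok_mono) (use False in simp_all)
  qed
next
  fix j assume j: "j < m" "?lab (T j) = 2" "?lab (H j) = 1" "?keep (T j) = Suc j"
  have H: "H j \<noteq> T k" "lab (H j) = 1" using j(3) by (cases "H j = T k"; simp)+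
  show "?keep (H j) \<noteq> Suc j"
  proof (cases "T j = T k")
    case True
    have "label_ok lab keep (H j)" using sound_label_ok[OF s] H(2) by simp
    with label_ok_head[OF this H(2)] show ?thesis using H(1) True k(2,3) by auto
  next
    case False
    then show ?thesis using sound_not_mutual[OF s j(1) _ H(2)] H(1) j(2,4) by simp
  qed
next
  fix r s assume "?lab r \<noteq> 0" "?keep r = 0" "s \<in> seeds"
  moreover from this have "r \<noteq> T k" by auto
  ultimately show "(s, r) \<notin> linked" using sound_root_not_seed[OF s, of r s] by simp
next
  fix r r' assume "?lab r \<noteq> 0" "?keep r = 0" "?lab r' \<noteq> 0" "?keep r' = 0" "(r, r') \<in> linked"
  moreover from this have "r \<noteq> T k" "r' \<noteq> T k" by auto
  ultimately show "r = r'" using sound_roots_not_linked[OF s, of r r'] by simp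
qed

text \<open>When all labelled vertices are expanded, they form a union of components. So
  \<open>v\<close> opens a new component, and one without seeds, since these are labelled.\<close>

lemma sound_root:
  assumes s: "sound lab keep" and v: "v < n" "lab v = 0"
    and l: "l = 1 \<and> indeg v \<le> outdeg v \<or> l = 2 \<and> outdeg v \<le> indeg v"
    and seeds: "\<And>s. s \<in> seeds \<Longrightarrow> lab s \<noteq> 0"
    and closed: "\<And>u. lab u \<noteq> 0 \<Longrightarrow> expanded lab u"
  shows "sound (lab(v := l)) (keep(v := 0))" (is "sound ?lab ?keep")
proof (rule soundI)
  have "v \<in> {u. lab u \<noteq> 0}" if "(x, v) \<in> linked" "lab x \<noteq> 0" for x
  proof (rule linked_closed[OF that(1)])
    show "b \<in> {u. lab u \<noteq> 0}" if "a \<in> {u. lab u \<noteq> 0}" "(a, b) \<in> eligible \<or> (b, a) \<in> eligible" for a b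
      using that closed[of a] unfolding expanded_def by blast
  qed (use that in simp)
  then have new: "(u, v) \<notin> linked" "(v, u) \<notin> linked" if "lab u \<noteq> 0" for u
    using v that linked_sym by blast+
  {
    fix u assume "?lab u \<noteq> 0"
    then show "label_ok ?lab ?keep u"
    proof (cases "u = v")
      case True
      then show ?thesis using v l by (auto simp: label_ok_def)
    next
      case False
      then have "label_ok lab keep u" using sound_label_ok[OF s] \<open>?lab u \<noteq> 0\<close> by simp
      then show ?thesis by (rule label_ok_mono) (use False l in auto)
    qed
  next
    fix j assume j: "j < m" "?lab (T j) = 2" "?lab (H j) = 1" "?keep (T j) = Suc j"
    then show "?keep (H j) \<noteq> Suc j"
      using sound_not_mutual[OF s j(1)] by (cases "T j = v"; cases "H j = v") simp_all
  next
    fix r s assume "?lab r \<noteq> 0" "?keep r = 0" "s \<in> seeds"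
    then show "(s, r) \<notin> linked" using sound_root_not_seed[OF s, of r] new(1) seeds
      by (cases "r = v") simp_all
  next
    fix r r' assume "?lab r \<noteq> 0" "?keep r = 0" "?lab r' \<noteq> 0" "?keep r' = 0" "(r, r') \<in> linked"
    then show "r = r'" using sound_roots_not_linked[OF s, of r r'] new
      by (cases "r = v"; cases "r' = v") simp_all
  }
qed

end

section \<open>Reasoning about word RAM programs\<close>

text \<open>The postcondition receives the final state and the credits left of the \<open>T\<close> time units granted.\<close>

definition wp :: "nat \<Rightarrow> program \<Rightarrow> (state \<Rightarrow> nat \<Rightarrow> bool) \<Rightarrow> state \<Rightarrow> nat \<Rightarrow> bool" where
  "wp w P Q s T \<longleftrightarrow> (\<exists>t s'. run w P s t s' \<and> t \<le> T \<and> Q s' (T - t))"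

lemma wp_Skip: "wp w Skip Q s T \<longleftrightarrow> 0 < T \<and> Q s (T - 1)"
  unfolding wp_def by (auto elim!: run_SkipE intro!: exI[of _ 1] run.Skip)

lemma wp_Assign:
  "wp w (Assign x e) Q s T \<longleftrightarrow> address_ok w e s \<and> expression_val e s \<le> w \<and> 0 < T \<and>
     Q (s\<lparr>regs := (regs s)(x := expression_val e s)\<rparr>) (T - 1)"
  unfolding wp_def by (auto elim!: run_AssignE intro!: exI[of _ 1] run.Assign)

lemma wp_Store:
  "wp w (Store X a b) Q s T \<longleftrightarrow> operand_val a s \<le> w \<and> operand_val b s \<le> w \<and> 0 < T \<and>
     Q (s\<lparr>cells := (cells s)(X := (cells s X)(operand_val a s := operand_val b s))\<rparr>) (T - 1)"
  unfolding wp_def by (auto elim!: run_StoreE intro!: exI[of _ 1] run.Store)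

lemma wp_Seq: "wp w (Seq P R) Q s T \<longleftrightarrow> wp w P (wp w R Q) s T"
proof
  assume "wp w (Seq P R) Q s T"
  then obtain t s' where r: "run w (Seq P R) s t s'" "t \<le> T" "Q s' (T - t)" by (auto simp: wp_def)
  from r(1) obtain t1 s1 t2 where "t = t1 + t2" "run w P s t1 s1" "run w R s1 t2 s'"
    by (auto elim!: run_SeqE)
  with r show "wp w P (wp w R Q) s T" unfolding wp_def
    by (intro exI[of _ t1] exI[of _ s1] conjI exI[of _ t2] exI[of _ s']) auto
next
  assume "wp w P (wp w R Q) s T"
  then obtain t1 s1 t2 s2 where r: "run w P s t1 s1" "t1 \<le> T" "run w R s1 t2 s2" "t2 \<le> T - t1" "Q s2 (T - t1 - t2)"
    by (auto simp: wp_def)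
  then show "wp w (Seq P R) Q s T" unfolding wp_def
    by (intro exI[of _ "t1 + t2"] exI[of _ s2]) (auto intro: run.Seq)
qed

lemma wp_Seq_fun: "wp w (Seq P R) Q = wp w P (wp w R Q)"
  by (intro ext) (rule wp_Seq)

lemma wp_If: "wp w (If b P R) Q s T \<longleftrightarrow> 0 < T \<and> (if test_val b s then wp w P Q s (T - 1) else wp w R Q s (T - 1))"
proof
  assume "wp w (If b P R) Q s T"
  then obtain t s' where r: "run w (If b P R) s t s'" "t \<le> T" "Q s' (T - t)" by (auto simp: wp_def)
  from r(1) obtain u where "t = 1 + u" "run w (if test_val b s then P else R) s u s'"
    by (auto elim!: run_IfE)
  with r show "0 < T \<and> (if test_val b s then wp w P Q s (T - 1) else wp w R Q s (T - 1))"
    by (auto simp: wp_def intro!: exI[of _ u] exI[of _ s'])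
next
  assume a: "0 < T \<and> (if test_val b s then wp w P Q s (T - 1) else wp w R Q s (T - 1))"
  then obtain t s' where "run w (if test_val b s then P else R) s t s'" "t \<le> T - 1" "Q s' (T - 1 - t)"
    by (auto simp: wp_def split: if_splits)
  moreover from this(1) have "run w (If b P R) s (1 + t) s'"
    by (metis run.IfFalse run.IfTrue)
  ultimately show "wp w (If b P R) Q s T" unfolding wp_def
    using a by (intro exI[of _ "1 + t"] exI[of _ s']) auto
qed

lemmas wp_simps = wp_Skip wp_Assign wp_Store wp_Seq wp_If

text \<open>Every round takes time, so the credits themselves serve as the termination measure.\<close>

lemma wp_While:
  assumes "I s T"
    and step: "\<And>s T. I s T \<Longrightarrow> 0 < T \<and> (if test_val b s then wp w P I s (T - 1) else Q s (T - 1))"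
  shows "wp w (While b P) Q s T"
  using assms(1)
proof (induction T arbitrary: s rule: less_induct)
  case (less T)
  note st = step[OF less.prems]
  show ?case
  proof (cases "test_val b s")
    case True
    with st obtain t1 s1 where 1: "run w P s t1 s1" "t1 \<le> T - 1" "I s1 (T - 1 - t1)" by (auto simp: wp_def)
    with st less.IH[of "T - 1 - t1" s1] obtain t2 s2 where
      2: "run w (While b P) s1 t2 s2" "t2 \<le> T - 1 - t1" "Q s2 (T - 1 - t1 - t2)" by (auto simp: wp_def)
    have "run w (While b P) s (1 + t1 + t2) s2" by (rule run.WhileTrue[OF True 1(1) 2(1)])
    with st 1 2 show ?thesis unfolding wp_def
      by (intro exI[of _ "1 + t1 + t2"] exI[of _ s2]) auto
  next
    case False
    with st run.WhileFalse[OF False] show ?thesis unfolding wp_def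
      by (intro exI[of _ 1] exI[of _ s]) auto
  qed
qed

section \<open>Linked lists of arcs\<close>

text \<open>
  The arcs leaving \<open>v\<close> form a linked list with first pointer \<open>last_occ T v m\<close>, those entering \<open>v\<close> one with
  first pointer \<open>last_occ H v m\<close>. A pointer is an arc index plus one, and 0 ends the list.
\<close>

primrec last_occ :: "(nat \<Rightarrow> nat) \<Rightarrow> nat \<Rightarrow> nat \<Rightarrow> nat" where
  "last_occ f v 0 = 0"
| "last_occ f v (Suc k) = (if f k = v then Suc k else last_occ f v k)"

text \<open>The link of arc \<open>j\<close> is the first pointer of its list just before
  \<open>j\<close> was put in front. It is 0 for arcs not yet entered, like the initial
  array.\<close>

definition links :: "(nat \<Rightarrow> nat) \<Rightarrow> nat \<Rightarrow> nat \<Rightarrow> nat" where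
  "links f k j = (if j < k then last_occ f (f j) j else 0)"

lemma last_occ_le: "last_occ f v k \<le> k"
  by (induction k) auto

lemma last_occ_SucD: "last_occ f v k = Suc j \<Longrightarrow> j < k \<and> f j = v"
  by (induction k) (auto split: if_splits)

lemma last_occ_above: "last_occ f v k \<le> j \<Longrightarrow> j < k \<Longrightarrow> f j \<noteq> v"
  by (induction k) (auto simp: less_Suc_eq split: if_splits)

text \<open>No occurrence is lost by cutting off behind the last one. Hence one step along a list
  lowers the count by exactly one, which pays for that step.\<close>

lemma occurrences_last_occ: "occurrences f (last_occ f v k) v = occurrences f k v"
  by (induction k) (auto simp: occurrences_Suc)

lemma last_occ_fun_Suc: "(\<lambda>v. last_occ f v (Suc k)) = (\<lambda>v. last_occ f v k)(f k := Suc k)"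
  by (auto simp: fun_eq_iff)

lemma links_0: "links f 0 = (\<lambda>_. 0)"
  by (simp add: links_def fun_eq_iff)

lemma links_Suc: "links f (Suc k) = (links f k)(k := last_occ f (f k) k)"
  by (auto simp: links_def fun_eq_iff)


section \<open>The program\<close>

text \<open>
  Arrays: \<open>I\<close>, \<open>O\<close> hold the in- and out-degrees, \<open>F\<close>, \<open>N\<close> the first pointers and links of the lists of
  out-arcs, \<open>G\<close>, \<open>M\<close> those of the in-arcs, \<open>L\<close> the labels, \<open>K\<close> the kept arcs, \<open>Q\<close> the queue, which occupies
  the positions below register \<open>t\<close> and is expanded below register \<open>h\<close>. The vertices below register \<open>r\<close>
  have been considered as roots.
\<close>

notation Seq (infixr ";;" 60)

definition label_vertex :: "string \<Rightarrow> nat \<Rightarrow> operand \<Rightarrow> program" where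
  "label_vertex x l p =
     Store ''L'' (Reg x) (Const l) ;; Store ''K'' (Reg x) p ;;
     Store ''Q'' (Reg ''t'') (Reg x) ;; Assign ''t'' (Add (Reg ''t'') (Const 1))"

text \<open>Expects an arc index in \<open>k\<close> and its pointer, one larger, in
  \<open>p\<close>. The registers \<open>h\<close>, \<open>r\<close>, \<open>v\<close>,
  \<open>k\<close> and \<open>p\<close> of the surrounding loops are left alone.\<close>

definition try_head :: program where
  "try_head =
     Assign ''b'' (Load ''head'' (Reg ''k'')) ;; Assign ''l'' (Load ''L'' (Reg ''b'')) ;;
     If (Equal (Reg ''l'') (Const 0))
       (Assign ''i'' (Load ''I'' (Reg ''b'')) ;; Assign ''o'' (Load ''O'' (Reg ''b'')) ;;
        If (Less (Reg ''o'') (Reg ''i'')) Skip (label_vertex ''b'' 1 (Reg ''p'')))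
       Skip"

definition try_tail :: program where
  "try_tail =
     Assign ''a'' (Load ''tail'' (Reg ''k'')) ;; Assign ''l'' (Load ''L'' (Reg ''a'')) ;;
     If (Equal (Reg ''l'') (Const 0))
       (Assign ''i'' (Load ''I'' (Reg ''a'')) ;; Assign ''o'' (Load ''O'' (Reg ''a'')) ;;
        If (Less (Reg ''i'') (Reg ''o'')) Skip (label_vertex ''a'' 2 (Reg ''p'')))
       Skip"

definition count_arc :: program where
  "count_arc =
     Assign ''a'' (Load ''tail'' (Reg ''k'')) ;; Assign ''b'' (Load ''head'' (Reg ''k'')) ;;
     Assign ''p'' (Add (Reg ''k'') (Const 1)) ;;
     Assign ''i'' (Load ''O'' (Reg ''a'')) ;; Assign ''i'' (Add (Reg ''i'') (Const 1)) ;;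
     Store ''O'' (Reg ''a'') (Reg ''i'') ;;
     Assign ''i'' (Load ''I'' (Reg ''b'')) ;; Assign ''i'' (Add (Reg ''i'') (Const 1)) ;;
     Store ''I'' (Reg ''b'') (Reg ''i'') ;;
     Assign ''i'' (Load ''F'' (Reg ''a'')) ;; Store ''N'' (Reg ''k'') (Reg ''i'') ;;
     Store ''F'' (Reg ''a'') (Reg ''p'') ;;
     Assign ''i'' (Load ''G'' (Reg ''b'')) ;; Store ''M'' (Reg ''k'') (Reg ''i'') ;;
     Store ''G'' (Reg ''b'') (Reg ''p'') ;;
     Assign ''k'' (Val (Reg ''p''))"

definition count_degrees :: program where
  "count_degrees = While (Less (Reg ''k'') (Reg ''m'')) count_arc"

definition seed_head :: program where
  "seed_head =
     Assign ''p'' (Add (Reg ''k'') (Const 1)) ;; Assign ''a'' (Load ''tail'' (Reg ''k'')) ;;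
     Assign ''i'' (Load ''I'' (Reg ''a'')) ;; Assign ''o'' (Load ''O'' (Reg ''a'')) ;;
     If (Less (Reg ''i'') (Reg ''o'')) try_head Skip"

definition seed_tail :: program where
  "seed_tail =
     Assign ''p'' (Add (Reg ''k'') (Const 1)) ;; Assign ''b'' (Load ''head'' (Reg ''k'')) ;;
     Assign ''i'' (Load ''I'' (Reg ''b'')) ;; Assign ''o'' (Load ''O'' (Reg ''b'')) ;;
     If (Less (Reg ''o'') (Reg ''i'')) try_tail Skip"

definition label_seeds :: program where
  "label_seeds =
     Assign ''k'' (Val (Const 0)) ;;
     While (Less (Reg ''k'') (Reg ''m''))
       (seed_head ;; seed_tail ;; Assign ''k'' (Add (Reg ''k'') (Const 1)))"

definition scan :: "string \<Rightarrow> string \<Rightarrow> program \<Rightarrow> program" where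
  "scan first next visit =
     Assign ''p'' (Load first (Reg ''v'')) ;;
     While (Unequal (Reg ''p'') (Const 0))
       (Assign ''k'' (Sub (Reg ''p'') (Const 1)) ;; visit ;; Assign ''p'' (Load next (Reg ''k'')))"

definition expand_vertex :: program where
  "expand_vertex =
     Assign ''v'' (Load ''Q'' (Reg ''h'')) ;;
     scan ''F'' ''N'' try_head ;; scan ''G'' ''M'' try_tail ;;
     Assign ''h'' (Add (Reg ''h'') (Const 1))"

definition try_root :: program where
  "try_root =
     Assign ''l'' (Load ''L'' (Reg ''r'')) ;;
     If (Equal (Reg ''l'') (Const 0))
       (Assign ''i'' (Load ''I'' (Reg ''r'')) ;; Assign ''o'' (Load ''O'' (Reg ''r'')) ;;
        If (Less (Reg ''o'') (Reg ''i''))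
          (label_vertex ''r'' 2 (Const 0)) (label_vertex ''r'' 1 (Const 0)))
       Skip ;;
     Assign ''r'' (Add (Reg ''r'') (Const 1))"

text \<open>A root is taken only when the queue is exhausted, as \<open>sound_root\<close> requires.
  The loop may stop before the queue is exhausted: with \<open>r\<close> at \<open>n\<close> every
  vertex is labelled.\<close>

definition search :: program where
  "search =
     While (Less (Reg ''r'') (Reg ''n''))
       (If (Less (Reg ''h'') (Reg ''t'')) expand_vertex try_root)"

definition mark_unless_kept :: "string \<Rightarrow> nat \<Rightarrow> program" where
  "mark_unless_kept X l =
     Assign ''v'' (Load X (Reg ''k'')) ;;
     Assign ''l'' (Load ''L'' (Reg ''v'')) ;; Assign ''i'' (Load ''K'' (Reg ''v'')) ;;
     Assign ''p'' (Add (Reg ''k'') (Const 1)) ;;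
     If (Equal (Reg ''l'') (Const l))
       (If (Unequal (Reg ''i'') (Reg ''p'')) (Store ''out'' (Reg ''k'') (Const 1)) Skip) Skip"

definition mark_deleted :: program where
  "mark_deleted =
     Assign ''k'' (Val (Const 0)) ;;
     While (Less (Reg ''k'') (Reg ''m''))
       (mark_unless_kept ''head'' 1 ;; mark_unless_kept ''tail'' 2 ;;
        Assign ''k'' (Add (Reg ''k'') (Const 1)))"

definition funnel_program :: program where
  "funnel_program = count_degrees ;; label_seeds ;; search ;; mark_deleted"

section \<open>Correctness and running time of the program\<close>

context indexed_dag
begin

section \<open>Counting degrees and building the lists\<close>

text \<open>For \<open>k\<close> below \<open>m\<close> this is the invariant of the first loop;
  \<open>counted m\<close> is the data that the search only reads.\<close>

definition counted :: "nat \<Rightarrow> state \<Rightarrow> bool" where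
  "counted k s \<longleftrightarrow> regs s ''n'' = n \<and> regs s ''m'' = m \<and> cells s ''tail'' = T \<and> cells s ''head'' = H \<and>
     cells s ''out'' = (\<lambda>_. 0) \<and>
     cells s ''I'' = occurrences H k \<and> cells s ''O'' = occurrences T k \<and>
     cells s ''F'' = (\<lambda>v. last_occ T v k) \<and> cells s ''G'' = (\<lambda>v. last_occ H v k) \<and>
     cells s ''N'' = links T k \<and> cells s ''M'' = links H k"

definition fresh :: "state \<Rightarrow> bool" where
  "fresh s \<longleftrightarrow> regs s ''t'' = 0 \<and> regs s ''h'' = 0 \<and> regs s ''r'' = 0 \<and>
     cells s ''L'' = (\<lambda>_. 0) \<and> cells s ''K'' = (\<lambda>_. 0)"

text \<open>The phase lemmas share this form: \<open>c\<close> is the credit to be left for the rest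
  of the program. The word size \<open>n + m + 2\<close> covers degrees, pointers, queue positions
  and the label 2.\<close>

lemma count_degrees_wp:
  assumes w: "n + m + 2 \<le> w" and s: "counted 0 s" "fresh s" "regs s ''k'' = 0"
    and T: "20 * m + 1 + c \<le> T0"
    and Q: "\<And>s' T'. counted m s' \<Longrightarrow> fresh s' \<Longrightarrow> c \<le> T' \<Longrightarrow> Q s' T'"
  shows "wp w count_degrees Q s T0"
  unfolding count_degrees_def
proof (rule wp_While[where I = "\<lambda>s T'. regs s ''k'' \<le> m \<and> counted (regs s ''k'') s \<and> fresh s \<and>
    20 * (m - regs s ''k'') + 1 + c \<le> T'"])
  fix s T'
  assume I: "regs s ''k'' \<le> m \<and> counted (regs s ''k'') s \<and> fresh s \<and> 20 * (m - regs s ''k'') + 1 + c \<le> T'"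
  define k where "k = regs s ''k''"
  show "0 < T' \<and> (if test_val (Less (Reg ''k'') (Reg ''m'')) s then
     wp w count_arc
       (\<lambda>s T'. regs s ''k'' \<le> m \<and> counted (regs s ''k'') s \<and> fresh s \<and> 20 * (m - regs s ''k'') + 1 + c \<le> T')
       s (T' - 1)
     else Q s (T' - 1))"
  proof (cases "k < m")
    case True
    have b: "T k < n" "H k < n" using True T_less H_less by auto
    have le: "occurrences f k v \<le> k" "last_occ f v k \<le> k" for f v
      by (rule occurrences_le) (rule last_occ_le)
    have l: "Suc (occurrences f k v) \<le> w" "last_occ f v k \<le> w" "Suc k \<le> w" "T k \<le> w" "H k \<le> w" "k \<le> w" for f v
      using le(1)[of f v] le(2)[of f v] True w b by linarith+
    \<comment> \<open>The loop test and the 16 operations of \<open>count_arc\<close> fit into the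
      20 units granted per arc.\<close>
    have "20 * (m - k) = 20 * (m - Suc k) + 20" using True by simp
    moreover define u where "u = T' - 20"
    ultimately have u: "T' = u + 20" "20 * (m - Suc k) + 1 + c \<le> u"
      using I unfolding k_def by linarith+
    have s: "regs s ''k'' = k" "regs s ''n'' = n" "regs s ''m'' = m" "cells s ''tail'' = T" "cells s ''head'' = H"
      "cells s ''out'' = (\<lambda>_. 0)" "cells s ''I'' = occurrences H k" "cells s ''O'' = occurrences T k"
      "cells s ''F'' = (\<lambda>v. last_occ T v k)" "cells s ''G'' = (\<lambda>v. last_occ H v k)"
      "cells s ''N'' = links T k" "cells s ''M'' = links H k"
      "regs s ''t'' = 0" "regs s ''h'' = 0" "regs s ''r'' = 0" "cells s ''L'' = (\<lambda>_. 0)" "cells s ''K'' = (\<lambda>_. 0)"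
      using I by (simp_all add: counted_def fresh_def k_def)
    show ?thesis
      unfolding count_arc_def counted_def fresh_def u(1)
      using True u(2)
      by (simp add: wp_simps s l Suc_leD[OF l(1)] occurrences_Suc last_occ_fun_Suc links_Suc del: last_occ.simps)
  next
    case False
    with I Q[of s "T' - 1"] show ?thesis by (auto simp: counted_def k_def[symmetric])
  qed
qed (use s T in simp)

section \<open>Labelling one end of an arc\<close>

definition searching :: "state \<Rightarrow> bool" where
  "searching s \<longleftrightarrow> counted m s \<and> sound (cells s ''L'') (cells s ''K'') \<and>
     queue (cells s ''L'') (cells s ''Q'') (regs s ''t'')"

text \<open>A frame condition, transitive so that it carries facts about labels and queue entries
  through sequences and loops.\<close>

definition extends :: "string set \<Rightarrow> state \<Rightarrow> state \<Rightarrow> bool" where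
  "extends X s s' \<longleftrightarrow> (\<forall>x\<in>X. regs s' x = regs s x) \<and>
     (\<forall>v. cells s ''L'' v \<noteq> 0 \<longrightarrow> cells s' ''L'' v \<noteq> 0) \<and>
     regs s ''t'' \<le> regs s' ''t'' \<and> (\<forall>i<regs s ''t''. cells s' ''Q'' i = cells s ''Q'' i)"

lemma extends_refl: "extends X s s"
  by (simp add: extends_def)

lemma extends_trans: "extends X s s' \<Longrightarrow> extends X s' s'' \<Longrightarrow> extends X s s''"
  by (auto simp: extends_def)

lemma extends_mono: "extends X s s' \<Longrightarrow> Y \<subseteq> X \<Longrightarrow> extends Y s s'"
  by (auto simp: extends_def)

lemma searching_counted:
  assumes "searching s"
  shows "regs s ''n'' = n" "regs s ''m'' = m" "cells s ''tail'' = T" "cells s ''head'' = H"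
    "cells s ''out'' = (\<lambda>_. 0)" "cells s ''I'' = indeg" "cells s ''O'' = outdeg"
    "cells s ''F'' = (\<lambda>v. last_occ T v m)" "cells s ''G'' = (\<lambda>v. last_occ H v m)"
    "cells s ''N'' = links T m" "cells s ''M'' = links H m"
  using assms by (simp_all add: searching_def counted_def)

lemma searching_sound: "searching s \<Longrightarrow> sound (cells s ''L'') (cells s ''K'')"
  and searching_queue: "searching s \<Longrightarrow> queue (cells s ''L'') (cells s ''Q'') (regs s ''t'')"
  by (simp_all add: searching_def)

lemma try_head_wp:
  assumes w: "n + m + 2 \<le> w" and s: "searching s" "regs s ''k'' = k" "k < m" "regs s ''p'' = Suc k"
    and p: "cells s ''L'' (T k) \<noteq> 0 \<or> indeg (T k) < outdeg (T k)"
    and T: "12 + c \<le> T0"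
    and Q: "\<And>s' T'. searching s' \<Longrightarrow> extends {''h'', ''r'', ''v'', ''k'', ''p''} s s' \<Longrightarrow>
      (indeg (H k) \<le> outdeg (H k) \<Longrightarrow> cells s' ''L'' (H k) \<noteq> 0) \<Longrightarrow> c \<le> T' \<Longrightarrow> Q s' T'"
  shows "wp w try_head Q s T0"
proof -
  define u where "u = T0 - 12"
  have u: "T0 = u + 12" "c \<le> u" using T by (simp_all add: u_def)
  note c = searching_counted[OF s(1)] and q = searching_sound[OF s(1)] searching_queue[OF s(1)]
  have b: "H k < n" using s H_less by simp
  have "indeg v \<le> w" "outdeg v \<le> w" "k \<le> w" "Suc k \<le> w" "H k \<le> w" for v
    using w b s(3) occurrences_le[of H m v] occurrences_le[of T m v] by linarith+
  note l = this
  have "Suc 0 \<le> w" using w by simp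
  note l = l this
  consider "cells s ''L'' (H k) \<noteq> 0" | "cells s ''L'' (H k) = 0" "outdeg (H k) < indeg (H k)"
    | "cells s ''L'' (H k) = 0" "indeg (H k) \<le> outdeg (H k)" by linarith
  then show ?thesis
  proof cases
    case 1
    have "cells s ''L'' (H k) \<le> w"
      using sound_label_ok[OF q(1) 1] w by (auto simp: label_ok_def)
    with 1 show ?thesis unfolding try_head_def u(1)
      by (simp add: wp_simps s(2,4) c l)
        (rule Q; use s 1 u in \<open>simp add: searching_def counted_def extends_def c q\<close>)
  next
    case 2
    then show ?thesis unfolding try_head_def u(1)
      by (simp add: wp_simps s(2,4) c l)
        (rule Q; use s u in \<open>simp add: searching_def counted_def extends_def c q\<close>)
  next
    case 3
    \<comment> \<open>An unlabelled vertex leaves room in the queue, so the address \<open>t\<close>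
      and its successor fit into a word.\<close>
    have t: "regs s ''t'' < n" by (rule queue_length_less[OF q(2,1) 3(1) b])
    have "regs s ''t'' \<le> w" "Suc (regs s ''t'') \<le> w" using t w by linarith+
    then show ?thesis unfolding try_head_def label_vertex_def u(1) using 3
      by (simp add: wp_simps s(2,4) c l)
        (rule Q; use s u p sound_label_head[OF q(1) s(3) 3 p] queue_push[OF q(2) 3(1), of 1] in
          \<open>simp add: searching_def counted_def extends_def c q\<close>)
  qed
qed

lemma try_tail_wp:
  assumes w: "n + m + 2 \<le> w" and s: "searching s" "regs s ''k'' = k" "k < m" "regs s ''p'' = Suc k"
    and p: "cells s ''L'' (H k) \<noteq> 0 \<or> outdeg (H k) < indeg (H k)"
    and T: "12 + c \<le> T0"
    and Q: "\<And>s' T'. searching s' \<Longrightarrow> extends {''h'', ''r'', ''v'', ''k'', ''p''} s s' \<Longrightarrow>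
      (outdeg (T k) \<le> indeg (T k) \<Longrightarrow> cells s' ''L'' (T k) \<noteq> 0) \<Longrightarrow> c \<le> T' \<Longrightarrow> Q s' T'"
  shows "wp w try_tail Q s T0"
proof -
  define u where "u = T0 - 12"
  have u: "T0 = u + 12" "c \<le> u" using T by (simp_all add: u_def)
  note c = searching_counted[OF s(1)] and q = searching_sound[OF s(1)] searching_queue[OF s(1)]
  have b: "T k < n" using s T_less by simp
  have "outdeg v \<le> w" "indeg v \<le> w" "k \<le> w" "Suc k \<le> w" "T k \<le> w" for v
    using w b s(3) occurrences_le[of H m v] occurrences_le[of T m v] by linarith+
  note l = this
  have "2 \<le> w" using w by simp
  note l = l this
  consider "cells s ''L'' (T k) \<noteq> 0" | "cells s ''L'' (T k) = 0" "indeg (T k) < outdeg (T k)"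
    | "cells s ''L'' (T k) = 0" "outdeg (T k) \<le> indeg (T k)" by linarith
  then show ?thesis
  proof cases
    case 1
    have "cells s ''L'' (T k) \<le> w"
      using sound_label_ok[OF q(1) 1] w by (auto simp: label_ok_def)
    with 1 show ?thesis unfolding try_tail_def u(1)
      by (simp add: wp_simps s(2,4) c l)
        (rule Q; use s 1 u in \<open>simp add: searching_def counted_def extends_def c q\<close>)
  next
    case 2
    then show ?thesis unfolding try_tail_def u(1)
      by (simp add: wp_simps s(2,4) c l)
        (rule Q; use s u in \<open>simp add: searching_def counted_def extends_def c q\<close>)
  next
    case 3
    have t: "regs s ''t'' < n" by (rule queue_length_less[OF q(2,1) 3(1) b])
    have "regs s ''t'' \<le> w" "Suc (regs s ''t'') \<le> w" using t w by linarith+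
    then show ?thesis unfolding try_tail_def label_vertex_def u(1) using 3
      by (simp add: wp_simps s(2,4) c l)
        (rule Q; use s u p sound_label_tail[OF q(1) s(3) 3 p] queue_push[OF q(2) 3(1), of 2] in
          \<open>simp add: searching_def counted_def extends_def c q\<close>)
  qed
qed


text \<open>Updates of scratch registers are peeled off one at a time; the equation for
  \<open>regs := regs s\<close> then restores the original state.\<close>

lemma searching_regs:
  "x \<notin> {''n'', ''m'', ''t''} \<Longrightarrow> searching (s\<lparr>regs := f(x := y)\<rparr>) \<longleftrightarrow> searching (s\<lparr>regs := f\<rparr>)"
  "searching (s\<lparr>regs := regs s\<rparr>) \<longleftrightarrow> searching s"
  by (auto simp: searching_def counted_def)

lemma extends_regs:
  "x \<notin> insert ''t'' X \<Longrightarrow> extends X (s\<lparr>regs := f(x := y)\<rparr>) s' \<longleftrightarrow> extends X (s\<lparr>regs := f\<rparr>) s'"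
  "x \<notin> insert ''t'' X \<Longrightarrow> extends X s (s'\<lparr>regs := f(x := y)\<rparr>) \<longleftrightarrow> extends X s (s'\<lparr>regs := f\<rparr>)"
  "extends X (s\<lparr>regs := regs s\<rparr>) s' \<longleftrightarrow> extends X s s'"
  "extends X s (s'\<lparr>regs := regs s'\<rparr>) \<longleftrightarrow> extends X s s'"
  by (auto simp: extends_def)

lemmas regs_simps = searching_regs extends_regs extends_refl

section \<open>Labelling the seeds\<close>

lemma seed_head_wp:
  assumes w: "n + m + 2 \<le> w" and s: "searching s" "regs s ''k'' = k" "k < m"
    and T: "18 + c \<le> T0"
    and Q: "\<And>s' T'. searching s' \<Longrightarrow> extends {''h'', ''r'', ''v'', ''k''} s s' \<Longrightarrow>
      (indeg (T k) < outdeg (T k) \<Longrightarrow> indeg (H k) \<le> outdeg (H k) \<Longrightarrow> cells s' ''L'' (H k) \<noteq> 0) \<Longrightarrow>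
      c \<le> T' \<Longrightarrow> Q s' T'"
  shows "wp w seed_head Q s T0"
proof -
  define u where "u = T0 - 18"
  have u: "T0 = u + 18" "c \<le> u" using T by (simp_all add: u_def)
  note c = searching_counted[OF s(1)]
  have "T k < n" using s T_less by simp
  have Q_extends: "Q s' T'"
    if "searching s'" "extends {''h'', ''r'', ''v'', ''k'', ''p''} (s\<lparr>regs := f\<rparr>) s'"
      "indeg (H k) \<le> outdeg (H k) \<Longrightarrow> 0 < cells s' ''L'' (H k)" "c \<le> T'"
      "\<forall>x \<in> {''h'', ''r'', ''v'', ''k'', ''t''}. f x = regs s x" for s' T' f
    using that by (intro Q) (auto simp: extends_def)
  from \<open>T k < n\<close> have "indeg v \<le> w" "outdeg v \<le> w" "k \<le> w" "Suc k \<le> w" "T k \<le> w" for v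
    using w s(3) occurrences_le[of H m v] occurrences_le[of T m v] by linarith+
  note l = this
  show ?thesis
  proof (cases "indeg (T k) < outdeg (T k)")
    case True
    show ?thesis unfolding seed_head_def u(1) using True
      by (simp add: wp_simps s(2) c l)
        (rule try_head_wp[OF w _ _ s(3), of _ c],
          use s u in \<open>simp_all add: regs_simps Q_extends\<close>)
  next
    case False
    then show ?thesis unfolding seed_head_def u(1)
      by (simp add: wp_simps s(2) c l)
        (rule Q; use s u in \<open>simp add: searching_def counted_def extends_def\<close>)
  qed
qed

lemma seed_tail_wp:
  assumes w: "n + m + 2 \<le> w" and s: "searching s" "regs s ''k'' = k" "k < m"
    and T: "18 + c \<le> T0"
    and Q: "\<And>s' T'. searching s' \<Longrightarrow> extends {''h'', ''r'', ''v'', ''k''} s s' \<Longrightarrow>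
      (outdeg (H k) < indeg (H k) \<Longrightarrow> outdeg (T k) \<le> indeg (T k) \<Longrightarrow> cells s' ''L'' (T k) \<noteq> 0) \<Longrightarrow>
      c \<le> T' \<Longrightarrow> Q s' T'"
  shows "wp w seed_tail Q s T0"
proof -
  define u where "u = T0 - 18"
  have u: "T0 = u + 18" "c \<le> u" using T by (simp_all add: u_def)
  note c = searching_counted[OF s(1)]
  have "H k < n" using s H_less by simp
  have Q_extends: "Q s' T'"
    if "searching s'" "extends {''h'', ''r'', ''v'', ''k'', ''p''} (s\<lparr>regs := f\<rparr>) s'"
      "outdeg (T k) \<le> indeg (T k) \<Longrightarrow> 0 < cells s' ''L'' (T k)" "c \<le> T'"
      "\<forall>x \<in> {''h'', ''r'', ''v'', ''k'', ''t''}. f x = regs s x" for s' T' f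
    using that by (intro Q) (auto simp: extends_def)
  from \<open>H k < n\<close> have "indeg v \<le> w" "outdeg v \<le> w" "k \<le> w" "Suc k \<le> w" "H k \<le> w" for v
    using w s(3) occurrences_le[of H m v] occurrences_le[of T m v] by linarith+
  note l = this
  show ?thesis
  proof (cases "outdeg (H k) < indeg (H k)")
    case True
    show ?thesis unfolding seed_tail_def u(1) using True
      by (simp add: wp_simps s(2) c l)
        (rule try_tail_wp[OF w _ _ s(3), of _ c],
          use s u in \<open>simp_all add: regs_simps Q_extends\<close>)
  next
    case False
    then show ?thesis unfolding seed_tail_def u(1)
      by (simp add: wp_simps s(2) c l)
        (rule Q; use s u in \<open>simp add: searching_def counted_def extends_def\<close>)
  qed
qed

lemma label_seeds_wp:
  assumes w: "n + m + 2 \<le> w" and s: "counted m s" "fresh s"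
    and T: "40 * m + 2 + c \<le> T0"
    and Q: "\<And>s' T'. searching s' \<Longrightarrow> regs s' ''h'' = 0 \<Longrightarrow> regs s' ''r'' = 0 \<Longrightarrow>
      (\<And>v. v \<in> seeds \<Longrightarrow> cells s' ''L'' v \<noteq> 0) \<Longrightarrow> c \<le> T' \<Longrightarrow> Q s' T'"
  shows "wp w label_seeds Q s T0"
proof -
  \<comment> \<open>\<open>S L j\<close> says that the seeds arising from arc \<open>j\<close> are
    labelled by \<open>L\<close>; over all arcs this covers \<open>seeds\<close>.\<close>
  define S where "S L j \<longleftrightarrow>
    (indeg (T j) < outdeg (T j) \<longrightarrow> indeg (H j) \<le> outdeg (H j) \<longrightarrow> L (H j) \<noteq> 0) \<and>
    (outdeg (H j) < indeg (H j) \<longrightarrow> outdeg (T j) \<le> indeg (T j) \<longrightarrow> L (T j) \<noteq> 0)" for L :: "nat \<Rightarrow> nat" and j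
  define J where "J s T' \<longleftrightarrow> searching s \<and> regs s ''h'' = 0 \<and> regs s ''r'' = 0 \<and> regs s ''k'' \<le> m \<and>
    (\<forall>j<regs s ''k''. S (cells s ''L'') j) \<and> 40 * (m - regs s ''k'') + 1 + c \<le> T'" for s T'
  have "J (s\<lparr>regs := (regs s)(''k'' := 0)\<rparr>) (T0 - 1)"
    using s T sound_init queue_init by (simp add: J_def searching_def counted_def fresh_def)
  moreover have "0 < T' \<and> (if test_val (Less (Reg ''k'') (Reg ''m'')) s then
      wp w (seed_head ;; seed_tail ;; Assign ''k'' (Add (Reg ''k'') (Const 1))) J s (T' - 1)
      else Q s (T' - 1))" if J: "J s T'" for s T'
  proof (cases "regs s ''k'' < m")
    case True
    define k where "k = regs s ''k''"
    have k: "k < m" "Suc k \<le> w" using True w by (simp_all add: k_def)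
    \<comment> \<open>Two calls at 18 units, the increment and the loop test make 38, within the 40
      units granted per arc.\<close>
    have "40 * (m - k) = 40 * (m - Suc k) + 40" using k by simp
    then have T': "18 + (18 + (1 + (40 * (m - Suc k) + 1 + c))) \<le> T' - 1"
      using J unfolding J_def k_def[symmetric] by linarith
    have s: "searching s" "regs s ''k'' = k" using J by (simp_all add: J_def k_def)
    have "wp w (seed_head ;; seed_tail ;; Assign ''k'' (Add (Reg ''k'') (Const 1))) J s (T' - 1)"
      unfolding wp_Seq
    proof (rule seed_head_wp[OF w s k(1) T'], rule seed_tail_wp[OF w _ _ k(1)])
      fix s1 T1 s2 T2
      assume 1: "extends {''h'', ''r'', ''v'', ''k''} s s1"
          "indeg (T k) < outdeg (T k) \<Longrightarrow> indeg (H k) \<le> outdeg (H k) \<Longrightarrow> cells s1 ''L'' (H k) \<noteq> 0"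
        and 2: "searching s2" "extends {''h'', ''r'', ''v'', ''k''} s1 s2"
          "outdeg (H k) < indeg (H k) \<Longrightarrow> outdeg (T k) \<le> indeg (T k) \<Longrightarrow> cells s2 ''L'' (T k) \<noteq> 0"
        and T2: "1 + (40 * (m - Suc k) + 1 + c) \<le> T2"
      have e: "extends {''h'', ''r'', ''v'', ''k''} s s2" using 1(1) 2(2) by (rule extends_trans)
      then have "regs s2 ''k'' = k" "regs s2 ''h'' = 0" "regs s2 ''r'' = 0"
        using J by (simp_all add: extends_def J_def k_def)
      moreover have "S (cells s2 ''L'') j" if "j < Suc k" for j
      proof (cases "j = k")
        case True
        then show ?thesis using 1(2) 2(2,3) by (auto simp: S_def extends_def)
      next
        case False
        then have "S (cells s ''L'') j" using J that by (simp add: J_def k_def)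
        then show ?thesis using e by (auto simp: S_def extends_def)
      qed
      ultimately show "wp w (Assign ''k'' (Add (Reg ''k'') (Const 1))) J s2 T2"
        using 2(1) T2 k by (simp add: wp_simps J_def) (simp add: searching_def counted_def)
    qed (use s in \<open>auto simp: extends_def\<close>)
    with True J show ?thesis using searching_counted[of s] by (simp add: J_def)
  next
    case False
    have "cells s ''L'' v \<noteq> 0" if "v \<in> seeds" for v
      using that False J by (auto simp: J_def S_def seeds_def)
    then have "Q s (T' - 1)" using J by (intro Q) (auto simp: J_def)
    with False J show ?thesis using searching_counted[of s] by (simp add: J_def)
  qed
  ultimately have "wp w (While (Less (Reg ''k'') (Reg ''m''))
      (seed_head ;; seed_tail ;; Assign ''k'' (Add (Reg ''k'') (Const 1)))) Q
      (s\<lparr>regs := (regs s)(''k'' := 0)\<rparr>) (T0 - 1)"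
    by (rule wp_While)
  then show ?thesis unfolding label_seeds_def using T by (simp add: wp_Seq wp_Assign)
qed

section \<open>Scanning the arcs at a vertex\<close>

text \<open>The invariant speaks of a bound \<open>k\<close>: the out-arcs of \<open>v\<close> from
  \<open>k\<close> on are done, and the pointer shows the last one below \<open>k\<close>. The
  credit is proportional to the number of those below \<open>k\<close>.\<close>

lemma scan_out_wp:
  assumes w: "n + m + 2 \<le> w" and s: "searching s" "regs s ''v'' = v" "v < n" "cells s ''L'' v \<noteq> 0"
    and T: "20 * outdeg v + 2 + c \<le> T0"
    and Q: "\<And>s' T'. searching s' \<Longrightarrow> extends {''h'', ''r'', ''v''} s s' \<Longrightarrow>
      (\<And>j. j < m \<Longrightarrow> T j = v \<Longrightarrow> indeg (H j) \<le> outdeg (H j) \<Longrightarrow> cells s' ''L'' (H j) \<noteq> 0) \<Longrightarrow>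
      c \<le> T' \<Longrightarrow> Q s' T'"
  shows "wp w (scan ''F'' ''N'' try_head) Q s T0"
proof -
  define J where "J s' T' \<longleftrightarrow> searching s' \<and> extends {''h'', ''r'', ''v''} s s' \<and>
    (\<exists>k\<le>m. regs s' ''p'' = last_occ T v k \<and>
    (\<forall>j<m. T j = v \<longrightarrow> k \<le> j \<longrightarrow> indeg (H j) \<le> outdeg (H j) \<longrightarrow> cells s' ''L'' (H j) \<noteq> 0) \<and>
    20 * occurrences T k v + 1 + c \<le> T')" for s' T'
  have vw: "v \<le> w" "last_occ T v m \<le> w" using w s(3) last_occ_le[of T v m] by linarith+
  have "J (s\<lparr>regs := (regs s)(''p'' := last_occ T v m)\<rparr>) (T0 - 1)"
    using s(1) T by (auto simp: J_def regs_simps intro!: exI[of _ m])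
  moreover have "0 < T' \<and> (if test_val (Unequal (Reg ''p'') (Const 0)) s' then
      wp w (Assign ''k'' (Sub (Reg ''p'') (Const 1)) ;; try_head ;; Assign ''p'' (Load ''N'' (Reg ''k''))) J s' (T' - 1)
      else Q s' (T' - 1))" if J: "J s' T'" for s' T'
  proof -
    obtain k where s': "searching s'" "extends {''h'', ''r'', ''v''} s s'" and k: "k \<le> m"
      "regs s' ''p'' = last_occ T v k"
      "\<And>j. j < m \<Longrightarrow> T j = v \<Longrightarrow> k \<le> j \<Longrightarrow> indeg (H j) \<le> outdeg (H j) \<Longrightarrow> cells s' ''L'' (H j) \<noteq> 0"
      "20 * occurrences T k v + 1 + c \<le> T'"
      using J unfolding J_def by blast
    show ?thesis
    proof (cases "regs s' ''p''")
      case 0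
      have "cells s' ''L'' (H j) \<noteq> 0" if "j < m" "T j = v" "indeg (H j) \<le> outdeg (H j)" for j
        using k(3)[OF that(1,2) _ that(3)] last_occ_above[of T v k j] that(2) k(2) 0 by fastforce
      then have "Q s' (T' - 1)" using k(4) by (intro Q s') auto
      then show ?thesis using k(4) 0 by simp
    next
      case (Suc i)
      with k have i: "i < k" "T i = v" "last_occ T v k = Suc i" using last_occ_SucD[of T v k i] by auto
      have im: "i < m" "i \<le> w" using i k(1) w by linarith+
      \<comment> \<open>Lowering the bound from \<open>k\<close> to \<open>i\<close> removes exactly
        one occurrence. Its 20 units cover the loop test, two assignments and the 12 units of
        \<open>try_head\<close>.\<close>
      have "occurrences T k v = Suc (occurrences T i v)"
        using occurrences_last_occ[of T v k] i by (simp add: occurrences_Suc)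
      then have "12 + (1 + (20 * occurrences T i v + 1 + c)) \<le> T' - 1 - 1" using k(4) by linarith
      note T' = this
      let ?s = "s'\<lparr>regs := (regs s')(''k'' := i)\<rparr>"
      have "wp w try_head (wp w (Assign ''p'' (Load ''N'' (Reg ''k''))) J) ?s (T' - 1 - 1)"
      proof (rule try_head_wp[OF w _ _ im(1) _ _ T'])
        fix s1 T1
        assume 1: "searching s1" "extends {''h'', ''r'', ''v'', ''k'', ''p''} ?s s1"
          "indeg (H i) \<le> outdeg (H i) \<Longrightarrow> cells s1 ''L'' (H i) \<noteq> 0" "1 + (20 * occurrences T i v + 1 + c) \<le> T1"
        have "extends {''h'', ''r'', ''v''} ?s s1" using 1(2) by (rule extends_mono) auto
        then have e1: "extends {''h'', ''r'', ''v''} s' s1" by (simp add: regs_simps)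
        have e: "extends {''h'', ''r'', ''v''} s s1" using s'(2) e1 by (rule extends_trans)
        have "regs s1 ''k'' = i" using 1(2) by (simp add: extends_def)
        moreover have "links T m i = last_occ T v i" using im i by (simp add: links_def)
        moreover have "cells s1 ''L'' (H j) \<noteq> 0" if "j < m" "T j = v" "i \<le> j" "indeg (H j) \<le> outdeg (H j)" for j
        proof (cases "j = i")
          case True
          then show ?thesis using 1(3) that by simp
        next
          case False
          \<comment> \<open>Arc \<open>i\<close> is the last out-arc of \<open>v\<close> below
            \<open>k\<close>, so a later one was handled before.\<close>
          have "k \<le> j"
          proof (rule ccontr)
            assume "\<not> k \<le> j"
            moreover have "last_occ T v k \<le> j" using i(3) that(3) False by simp
            ultimately show False using last_occ_above[of T v k j] that(2) by simp
          qed
          then have "cells s' ''L'' (H j) \<noteq> 0" using k(3) that by simp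
          then show ?thesis using e1 by (simp add: extends_def)
        qed
        moreover have "last_occ T v i \<le> w" using last_occ_le[of T v i] im by linarith
        moreover have "i \<le> m" using im by simp
        ultimately show "wp w (Assign ''p'' (Load ''N'' (Reg ''k''))) J s1 T1"
          using 1(1,4) e im searching_counted[OF 1(1)]
          by (auto simp: wp_Assign J_def regs_simps intro!: exI[of _ i])
      qed (use s' s(4) i Suc in \<open>auto simp: regs_simps extends_def\<close>)
      then show ?thesis using k(4) Suc im T' by (simp add: wp_Seq wp_Assign)
    qed
  qed
  ultimately have "wp w (While (Unequal (Reg ''p'') (Const 0))
      (Assign ''k'' (Sub (Reg ''p'') (Const 1)) ;; try_head ;; Assign ''p'' (Load ''N'' (Reg ''k'')))) Q
      (s\<lparr>regs := (regs s)(''p'' := last_occ T v m)\<rparr>) (T0 - 1)"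
    by (rule wp_While)
  then show ?thesis unfolding scan_def
    using T vw s(2) searching_counted[OF s(1)] by (simp add: wp_Seq wp_Assign)
qed

text \<open>The argument for \<open>scan_out_wp\<close> with tails and heads exchanged.\<close>

lemma scan_in_wp:
  assumes w: "n + m + 2 \<le> w" and s: "searching s" "regs s ''v'' = v" "v < n" "cells s ''L'' v \<noteq> 0"
    and T: "20 * indeg v + 2 + c \<le> T0"
    and Q: "\<And>s' T'. searching s' \<Longrightarrow> extends {''h'', ''r'', ''v''} s s' \<Longrightarrow>
      (\<And>j. j < m \<Longrightarrow> H j = v \<Longrightarrow> outdeg (T j) \<le> indeg (T j) \<Longrightarrow> cells s' ''L'' (T j) \<noteq> 0) \<Longrightarrow>
      c \<le> T' \<Longrightarrow> Q s' T'"
  shows "wp w (scan ''G'' ''M'' try_tail) Q s T0"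
proof -
  define J where "J s' T' \<longleftrightarrow> searching s' \<and> extends {''h'', ''r'', ''v''} s s' \<and>
    (\<exists>k\<le>m. regs s' ''p'' = last_occ H v k \<and>
    (\<forall>j<m. H j = v \<longrightarrow> k \<le> j \<longrightarrow> outdeg (T j) \<le> indeg (T j) \<longrightarrow> cells s' ''L'' (T j) \<noteq> 0) \<and>
    20 * occurrences H k v + 1 + c \<le> T')" for s' T'
  have vw: "v \<le> w" "last_occ H v m \<le> w" using w s(3) last_occ_le[of H v m] by linarith+
  have "J (s\<lparr>regs := (regs s)(''p'' := last_occ H v m)\<rparr>) (T0 - 1)"
    using s(1) T by (auto simp: J_def regs_simps intro!: exI[of _ m])
  moreover have "0 < T' \<and> (if test_val (Unequal (Reg ''p'') (Const 0)) s' then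
      wp w (Assign ''k'' (Sub (Reg ''p'') (Const 1)) ;; try_tail ;; Assign ''p'' (Load ''M'' (Reg ''k''))) J s' (T' - 1)
      else Q s' (T' - 1))" if J: "J s' T'" for s' T'
  proof -
    obtain k where s': "searching s'" "extends {''h'', ''r'', ''v''} s s'" and k: "k \<le> m"
      "regs s' ''p'' = last_occ H v k"
      "\<And>j. j < m \<Longrightarrow> H j = v \<Longrightarrow> k \<le> j \<Longrightarrow> outdeg (T j) \<le> indeg (T j) \<Longrightarrow> cells s' ''L'' (T j) \<noteq> 0"
      "20 * occurrences H k v + 1 + c \<le> T'"
      using J unfolding J_def by blast
    show ?thesis
    proof (cases "regs s' ''p''")
      case 0
      have "cells s' ''L'' (T j) \<noteq> 0" if "j < m" "H j = v" "outdeg (T j) \<le> indeg (T j)" for j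
        using k(3)[OF that(1,2) _ that(3)] last_occ_above[of H v k j] that(2) k(2) 0 by fastforce
      then have "Q s' (T' - 1)" using k(4) by (intro Q s') auto
      then show ?thesis using k(4) 0 by simp
    next
      case (Suc i)
      with k have i: "i < k" "H i = v" "last_occ H v k = Suc i" using last_occ_SucD[of H v k i] by auto
      have im: "i < m" "i \<le> w" using i k(1) w by linarith+
      have "occurrences H k v = Suc (occurrences H i v)"
        using occurrences_last_occ[of H v k] i by (simp add: occurrences_Suc)
      then have "12 + (1 + (20 * occurrences H i v + 1 + c)) \<le> T' - 1 - 1" using k(4) by linarith
      note T' = this
      let ?s = "s'\<lparr>regs := (regs s')(''k'' := i)\<rparr>"
      have "wp w try_tail (wp w (Assign ''p'' (Load ''M'' (Reg ''k''))) J) ?s (T' - 1 - 1)"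
      proof (rule try_tail_wp[OF w _ _ im(1) _ _ T'])
        fix s1 T1
        assume 1: "searching s1" "extends {''h'', ''r'', ''v'', ''k'', ''p''} ?s s1"
          "outdeg (T i) \<le> indeg (T i) \<Longrightarrow> cells s1 ''L'' (T i) \<noteq> 0" "1 + (20 * occurrences H i v + 1 + c) \<le> T1"
        have "extends {''h'', ''r'', ''v''} ?s s1" using 1(2) by (rule extends_mono) auto
        then have e1: "extends {''h'', ''r'', ''v''} s' s1" by (simp add: regs_simps)
        have e: "extends {''h'', ''r'', ''v''} s s1" using s'(2) e1 by (rule extends_trans)
        have "regs s1 ''k'' = i" using 1(2) by (simp add: extends_def)
        moreover have "links H m i = last_occ H v i" using im i by (simp add: links_def)
        moreover have "cells s1 ''L'' (T j) \<noteq> 0" if "j < m" "H j = v" "i \<le> j" "outdeg (T j) \<le> indeg (T j)" for j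
        proof (cases "j = i")
          case True
          then show ?thesis using 1(3) that by simp
        next
          case False
          have "k \<le> j"
          proof (rule ccontr)
            assume "\<not> k \<le> j"
            moreover have "last_occ H v k \<le> j" using i(3) that(3) False by simp
            ultimately show False using last_occ_above[of H v k j] that(2) by simp
          qed
          then have "cells s' ''L'' (T j) \<noteq> 0" using k(3) that by simp
          then show ?thesis using e1 by (simp add: extends_def)
        qed
        moreover have "last_occ H v i \<le> w" using last_occ_le[of H v i] im by linarith
        moreover have "i \<le> m" using im by simp
        ultimately show "wp w (Assign ''p'' (Load ''M'' (Reg ''k''))) J s1 T1"
          using 1(1,4) e im searching_counted[OF 1(1)]
          by (auto simp: wp_Assign J_def regs_simps intro!: exI[of _ i])
      qed (use s' s(4) i Suc in \<open>auto simp: regs_simps extends_def\<close>)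
      then show ?thesis using k(4) Suc im T' by (simp add: wp_Seq wp_Assign)
    qed
  qed
  ultimately have "wp w (While (Unequal (Reg ''p'') (Const 0))
      (Assign ''k'' (Sub (Reg ''p'') (Const 1)) ;; try_tail ;; Assign ''p'' (Load ''M'' (Reg ''k'')))) Q
      (s\<lparr>regs := (regs s)(''p'' := last_occ H v m)\<rparr>) (T0 - 1)"
    by (rule wp_While)
  then show ?thesis unfolding scan_def
    using T vw s(2) searching_counted[OF s(1)] by (simp add: wp_Seq wp_Assign)
qed


section \<open>The search and its potential\<close>

text \<open>The potential of the search: up to a constant factor, the cost of expanding all vertices
  not yet expanded, whether queued or not.\<close>

definition pending :: "state \<Rightarrow> nat" where
  "pending s = (\<Sum>v \<in> {..<n} - cells s ''Q'' ` {..<regs s ''h''}. 1 + indeg v + outdeg v)"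

lemma pending_le: "pending s \<le> n + 2 * m"
proof -
  have "pending s \<le> (\<Sum>v<n. 1 + indeg v + outdeg v)"
    unfolding pending_def by (intro sum_mono2) auto
  also have "\<dots> = n + 2 * m"
    using sum_occurrences[of m H n] sum_occurrences[of m T n] T_less H_less by (simp add: sum.distrib del: One_nat_def add_Suc plus_1_eq_Suc)
  finally show ?thesis .
qed

text \<open>The queue has no repetitions, so the vertex at position \<open>h\<close> was not
  expanded earlier and its summand is still in the potential.\<close>

lemma pending_expand:
  assumes s: "searching s" "regs s ''h'' < regs s ''t''" "cells s ''Q'' (regs s ''h'') = v"
    and s': "regs s' ''h'' = Suc (regs s ''h'')" "\<And>i. i < regs s ''t'' \<Longrightarrow> cells s' ''Q'' i = cells s ''Q'' i"
  shows "pending s = pending s' + (1 + indeg v + outdeg v)" "v < n" "cells s ''L'' v \<noteq> 0"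
proof -
  let ?h = "regs s ''h''" and ?q = "cells s ''Q''"
  have q: "inj_on ?q {..<regs s ''t''}" "?q ` {..<regs s ''t''} = {v. cells s ''L'' v \<noteq> 0}"
    using searching_queue[OF s(1)] by (auto simp: queue_def)
  show L: "cells s ''L'' v \<noteq> 0" using q(2) s(2,3) by blast
  then show v: "v < n" using sound_label_ok[OF searching_sound[OF s(1)]] by (simp add: label_ok_def)
  have "cells s' ''Q'' ` {..<Suc ?h} = ?q ` {..<Suc ?h}" using s'(2) s(2) by (intro image_cong) auto
  then have 1: "cells s' ''Q'' ` {..<regs s' ''h''} = insert v (?q ` {..<?h})"
    using s(3) s'(1) by (simp add: lessThan_Suc)
  have "v \<notin> ?q ` {..<?h}"
  proof
    assume "v \<in> ?q ` {..<?h}"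
    then obtain i where "i < ?h" "?q i = ?q ?h" using s(3) by auto
    then show False using q(1) s(2) by (auto simp: inj_on_def)
  qed
  moreover have "v \<in> {..<n}" using v by simp
  ultimately have 2: "{..<n} - ?q ` {..<?h} = insert v ({..<n} - insert v (?q ` {..<?h}))" by blast
  show "pending s = pending s' + (1 + indeg v + outdeg v)"
    unfolding pending_def 1 2 by (subst sum.insert) simp_all
qed

definition search_inv :: "state \<Rightarrow> bool" where
  "search_inv s \<longleftrightarrow> searching s \<and> regs s ''h'' \<le> regs s ''t'' \<and> regs s ''r'' \<le> n \<and>
     (\<forall>i<regs s ''h''. expanded (cells s ''L'') (cells s ''Q'' i)) \<and>
     (\<forall>v\<in>seeds. cells s ''L'' v \<noteq> 0) \<and> (\<forall>v<regs s ''r''. cells s ''L'' v \<noteq> 0)"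

lemma expand_vertex_wp:
  assumes w: "n + m + 2 \<le> w" and s: "search_inv s" "regs s ''h'' < regs s ''t''"
    and T: "60 * pending s + c \<le> T0"
    and Q: "\<And>s' T'. search_inv s' \<Longrightarrow> regs s' ''r'' = regs s ''r'' \<Longrightarrow>
      60 * pending s' + 10 + c \<le> T' \<Longrightarrow> Q s' T'"
  shows "wp w expand_vertex Q s T0"
proof -
  define v where "v = cells s ''Q'' (regs s ''h'')"
  have s0: "searching s" using s by (simp add: search_inv_def)
  have t: "regs s ''t'' \<le> n"
    using queue_length_le[OF searching_queue[OF s0] searching_sound[OF s0]] .
  note p = pending_expand[OF s0 s(2) v_def[symmetric]]
  have v: "v < n" "cells s ''L'' v \<noteq> 0"
    using p(2,3)[of "s\<lparr>regs := (regs s)(''h'' := Suc (regs s ''h''))\<rparr>"] by simp_all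
  have hw: "regs s ''h'' \<le> w" "Suc (regs s ''h'') \<le> w" "v \<le> w" using s(2) t v w by linarith+
  let ?s = "s\<lparr>regs := (regs s)(''v'' := v)\<rparr>"
  define d where "d = 60 * pending s + c - 60 * (1 + indeg v + outdeg v)"
  have d: "60 * pending s + c = d + 60 * (1 + indeg v + outdeg v)"
    using p(1)[of "s\<lparr>regs := (regs s)(''h'' := Suc (regs s ''h''))\<rparr>"] by (simp add: d_def)
  \<comment> \<open>Of the \<open>60 * (1 + indeg v + outdeg v)\<close> units released by expanding
    \<open>v\<close>, the two scans need at most 20 per arc and a constant. A surplus of 10 is
    handed back for the tests in \<open>search\<close>.\<close>
  have T1: "20 * outdeg v + 2 + (20 * indeg v + 2 + (1 + (10 + d))) \<le> T0 - 1"
    using T unfolding d by simp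
  have "wp w (scan ''F'' ''N'' try_head)
    (wp w (scan ''G'' ''M'' try_tail) (wp w (Assign ''h'' (Add (Reg ''h'') (Const 1))) Q)) ?s (T0 - 1)"
  proof (rule scan_out_wp[OF w _ _ v(1) _ T1])
    fix s1 T1
    assume 1: "searching s1" "extends {''h'', ''r'', ''v''} ?s s1"
      "\<And>j. j < m \<Longrightarrow> T j = v \<Longrightarrow> indeg (H j) \<le> outdeg (H j) \<Longrightarrow> cells s1 ''L'' (H j) \<noteq> 0"
      "20 * indeg v + 2 + (1 + (10 + d)) \<le> T1"
    show "wp w (scan ''G'' ''M'' try_tail) (wp w (Assign ''h'' (Add (Reg ''h'') (Const 1))) Q) s1 T1"
    proof (rule scan_in_wp[OF w 1(1) _ v(1) _ 1(4)])
      fix s2 T2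
      assume 2: "searching s2" "extends {''h'', ''r'', ''v''} s1 s2"
        "\<And>j. j < m \<Longrightarrow> H j = v \<Longrightarrow> outdeg (T j) \<le> indeg (T j) \<Longrightarrow> cells s2 ''L'' (T j) \<noteq> 0"
        "1 + (10 + d) \<le> T2"
      have e: "extends {''h'', ''r'', ''v''} ?s s2" using 1(2) 2(2) by (rule extends_trans)
      have r: "regs s2 ''h'' = regs s ''h''" "regs s2 ''r'' = regs s ''r''" "regs s ''t'' \<le> regs s2 ''t''"
        and mono: "\<And>x. cells s ''L'' x \<noteq> 0 \<Longrightarrow> cells s2 ''L'' x \<noteq> 0"
        and q: "\<And>i. i < regs s ''t'' \<Longrightarrow> cells s2 ''Q'' i = cells s ''Q'' i"
        using e by (auto simp: extends_def)
      have mono2: "cells s1 ''L'' x \<noteq> 0 \<Longrightarrow> cells s2 ''L'' x \<noteq> 0" for x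
        using 2(2) by (simp add: extends_def)
      let ?s2 = "s2\<lparr>regs := (regs s2)(''h'' := Suc (regs s ''h''))\<rparr>"
      have "expanded (cells s2 ''L'') v"
        unfolding expanded_def
      proof (intro allI impI, elim disjE)
        fix y assume "(v, y) \<in> eligible"
        then obtain k where "k < m" "T k = v" "y = H k" "indeg (H k) \<le> outdeg (H k)"
          unfolding eligible_def by blast
        then show "cells s2 ''L'' y \<noteq> 0" using 1(3) mono2 by metis
      next
        fix y assume "(y, v) \<in> eligible"
        then obtain k where "k < m" "H k = v" "y = T k" "outdeg (T k) \<le> indeg (T k)"
          unfolding eligible_def by blast
        then show "cells s2 ''L'' y \<noteq> 0" using 2(3) by metis
      qed
      have ex: "expanded (cells s2 ''L'') (cells s ''Q'' i)" if "i < regs s ''h''" for i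
      proof (rule expanded_mono[OF _ mono])
        show "expanded (cells s ''L'') (cells s ''Q'' i)"
          using s(1) that unfolding search_inv_def by blast
      qed
      have "expanded (cells s2 ''L'') (cells s2 ''Q'' i)" if "i < Suc (regs s ''h'')" for i
      proof (cases "i = regs s ''h''")
        case True
        then show ?thesis using \<open>expanded (cells s2 ''L'') v\<close> q[OF s(2)] by (simp add: v_def)
      next
        case False
        then show ?thesis using \<open>i < Suc (regs s ''h'')\<close> ex q[of i] s(2) by simp
      qed
      then have "search_inv ?s2"
        using s 2(1) r mono by (simp add: search_inv_def regs_simps)
      moreover have "60 * pending ?s2 + 10 + c \<le> T2 - 1"
        using p(1)[of ?s2] q d 2(4) by simp
      ultimately have "Q ?s2 (T2 - 1)" using r by (intro Q) auto
      then show "wp w (Assign ''h'' (Add (Reg ''h'') (Const 1))) Q s2 T2"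
        using 2(4) r hw by (simp add: wp_Assign)
    qed (use 1(2) v in \<open>auto simp: extends_def\<close>)
  qed (use s0 v in \<open>simp_all add: regs_simps\<close>)
  then show ?thesis unfolding expand_vertex_def
    using T d hw searching_counted[OF s0] by (simp add: wp_Seq_fun wp_Assign v_def)
qed

text \<open>An exhausted queue means \<open>h = t\<close>, so every labelled vertex is expanded and
  \<open>sound_root\<close> applies. The root takes the side of smaller degree.\<close>

lemma try_root_wp:
  assumes w: "n + m + 2 \<le> w" and s: "search_inv s" "\<not> regs s ''h'' < regs s ''t''" "regs s ''r'' < n"
    and T: "20 + c \<le> T0"
    and Q: "\<And>s' T'. search_inv s' \<Longrightarrow> regs s' ''r'' = Suc (regs s ''r'') \<Longrightarrow>
      pending s' = pending s \<Longrightarrow> c \<le> T' \<Longrightarrow> Q s' T'"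
  shows "wp w try_root Q s T0"
proof -
  define u where "u = T0 - 20"
  have u: "T0 = u + 20" "c \<le> u" using T by (simp_all add: u_def)
  define r where "r = regs s ''r''"
  have r: "regs s ''r'' = r" "r < n" using s(3) by (simp_all add: r_def)
  have s0: "searching s" using s by (simp add: search_inv_def)
  note c = searching_counted[OF s0] and q = searching_sound[OF s0] searching_queue[OF s0]
  have "indeg v \<le> w" "outdeg v \<le> w" "r \<le> w" "Suc r \<le> w" "Suc 0 \<le> w" "2 \<le> w" for v
    using w r occurrences_le[of H m v] occurrences_le[of T m v] by linarith+
  note l = this
  have th: "regs s ''t'' = regs s ''h''" using s by (simp add: search_inv_def)
  have seeds: "cells s ''L'' v \<noteq> 0" if "v \<in> seeds" for v using s(1) that by (simp add: search_inv_def)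
  have inv_r: "cells s ''L'' v \<noteq> 0" if "v < r" for v using s(1) that r by (simp add: search_inv_def)
  have exp: "expanded (cells s ''L'') (cells s ''Q'' i)" if "i < regs s ''h''" for i
    using s(1) that by (simp add: search_inv_def)
  show ?thesis
  proof (cases "cells s ''L'' r = 0")
    case False
    have "cells s ''L'' r \<le> w"
      using sound_label_ok[OF q(1) False] l by (auto simp: label_ok_def)
    then show ?thesis unfolding try_root_def u(1) using False
      by (simp add: wp_simps r c l)
        (rule Q; use s r u False in
          \<open>auto simp: search_inv_def searching_def counted_def pending_def less_Suc_eq\<close>)
  next
    case True
    have t: "regs s ''t'' < n" by (rule queue_length_less[OF q(2,1) True r(2)])
    then have hw: "regs s ''h'' \<le> w" "Suc (regs s ''h'') \<le> w" using th w by linarith+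
    have closed: "expanded (cells s ''L'') x" if "cells s ''L'' x \<noteq> 0" for x
    proof -
      have "x \<in> cells s ''Q'' ` {..<regs s ''h''}" using q(2) that th by (simp add: queue_def)
      then show ?thesis using exp by auto
    qed
    have Q_root: "Q s' T'"
      if l: "l = 1 \<and> indeg r \<le> outdeg r \<or> l = 2 \<and> outdeg r \<le> indeg r"
        and s': "counted m s'" "cells s' ''L'' = (cells s ''L'')(r := l)" "cells s' ''K'' = (cells s ''K'')(r := 0)"
        "cells s' ''Q'' = (cells s ''Q'')(regs s ''h'' := r)" "regs s' ''t'' = Suc (regs s ''h'')"
        "regs s' ''h'' = regs s ''h''" "regs s' ''r'' = Suc r" "c \<le> T'" for l s' T'
    proof (rule Q)
      have l0: "l \<noteq> 0" using l by auto
      have "sound (cells s' ''L'') (cells s' ''K'')"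
        unfolding s' by (rule sound_root[OF q(1) r(2) True l seeds closed])
      moreover have "queue (cells s' ''L'') (cells s' ''Q'') (regs s' ''t'')"
        unfolding s' using queue_push[OF q(2) True l0] th by simp
      moreover have "expanded (cells s' ''L'') (cells s' ''Q'' i)" if "i < regs s ''h''" for i
        unfolding s' using that l0 by (auto intro!: expanded_mono[OF exp])
      ultimately show "search_inv s'"
        unfolding search_inv_def searching_def using s' seeds inv_r r(2) l0 by (auto simp: less_Suc_eq)
      \<comment> \<open>The root is queued at position \<open>h\<close>, so the expanded part of the
        queue, and with it the potential, stays the same.\<close>
      have "cells s' ''Q'' ` {..<regs s' ''h''} = cells s ''Q'' ` {..<regs s ''h''}"
        unfolding s' by (intro image_cong) auto
      then show "pending s' = pending s" by (simp only: pending_def)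
    qed (use s' r in simp_all)
    show ?thesis
    proof (cases "outdeg r < indeg r")
      case less: True
      show ?thesis unfolding try_root_def u(1) label_vertex_def using True less
        by (simp add: wp_simps r c l hw th) (rule Q_root[of 2]; use u less in \<open>simp add: counted_def c\<close>)
    next
      case ge: False
      then show ?thesis unfolding try_root_def u(1) label_vertex_def using True
        by (simp add: wp_simps r c l hw th) (rule Q_root[of 1]; use u ge in \<open>simp add: counted_def c\<close>)
    qed
  qed
qed

lemma search_wp:
  assumes w: "n + m + 2 \<le> w" and s: "search_inv s" "regs s ''r'' = 0"
    and T: "90 * n + 120 * m + 1 + c \<le> T0"
    and Q: "\<And>s' T'. searching s' \<Longrightarrow> (\<And>v. v < n \<Longrightarrow> cells s' ''L'' v \<noteq> 0) \<Longrightarrow> c \<le> T' \<Longrightarrow> Q s' T'"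
  shows "wp w search Q s T0"
  unfolding search_def
\<comment> \<open>Expansions are paid by the potential, steps of \<open>r\<close> by 30 units per
  vertex. At the start this is at most \<open>60 * (n + 2 * m) + 30 * n\<close>.\<close>
proof (rule wp_While[where I = "\<lambda>s T'. search_inv s \<and> 60 * pending s + 30 * (n - regs s ''r'') + 1 + c \<le> T'"])
  show "search_inv s \<and> 60 * pending s + 30 * (n - regs s ''r'') + 1 + c \<le> T0"
    using s T pending_le[of s] by simp
  fix s T' assume J: "search_inv s \<and> 60 * pending s + 30 * (n - regs s ''r'') + 1 + c \<le> T'"
  then have s: "search_inv s" "searching s" by (simp_all add: search_inv_def)
  note c = searching_counted[OF s(2)]
  have pos: "0 < T'" using J by simp
  show "0 < T' \<and> (if test_val (Less (Reg ''r'') (Reg ''n'')) s then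
    wp w (If (Less (Reg ''h'') (Reg ''t'')) expand_vertex try_root)
      (\<lambda>s T'. search_inv s \<and> 60 * pending s + 30 * (n - regs s ''r'') + 1 + c \<le> T') s (T' - 1)
    else Q s (T' - 1))"
  proof (cases "regs s ''r'' < n")
    case r: True
    show ?thesis
    proof (cases "regs s ''h'' < regs s ''t''")
      case True
      \<comment> \<open>The subtracted 2 units are the loop test and the conditional; the surplus of
        10 from \<open>expand_vertex_wp\<close> makes up for them.\<close>
      have T': "60 * pending s + (30 * (n - regs s ''r'') + 1 + c - 2) \<le> T' - 1 - 1" "0 < T' - 1"
        using J r by linarith+
      show ?thesis unfolding wp_If
        by (simp only: test_val.simps operand_val.simps c r True if_True pos T'(2) simp_thms)
          (rule expand_vertex_wp[OF w s(1) True T'(1)], use r in simp)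
    next
      case False
      have "30 * (n - regs s ''r'') = 30 * (n - Suc (regs s ''r'')) + 30" using r by simp
      then have T': "20 + (60 * pending s + 30 * (n - Suc (regs s ''r'')) + 1 + c) \<le> T' - 1 - 1" "0 < T' - 1"
        using J by linarith+
      show ?thesis unfolding wp_If
        by (simp only: test_val.simps operand_val.simps c r False if_True if_False pos T'(2) simp_thms)
          (rule try_root_wp[OF w s(1) False r T'(1)], simp)
    qed
  next
    case False
    then have "Q s (T' - 1)" using J s by (intro Q) (auto simp: search_inv_def)
    then show ?thesis using False pos c by simp
  qed
qed

section \<open>Marking the deleted arcs\<close>

definition marking :: "(nat \<Rightarrow> nat) \<Rightarrow> (nat \<Rightarrow> nat) \<Rightarrow> state \<Rightarrow> bool" where
  "marking lab keep s \<longleftrightarrow> regs s ''m'' = m \<and> cells s ''tail'' = T \<and> cells s ''head'' = H \<and>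
     cells s ''L'' = lab \<and> cells s ''K'' = keep"

lemma label_keep_le:
  assumes "sound lab keep" "lab v \<noteq> 0"
  shows "lab v \<le> 2" "keep v \<le> m"
proof -
  have v: "label_ok lab keep v" using sound_label_ok assms by blast
  then have l: "lab v = 1 \<or> lab v = 2" unfolding label_ok_def by blast
  then show "lab v \<le> 2" by auto
  show "keep v \<le> m"
  proof (cases "keep v")
    case (Suc k)
    then have "k < m" using l label_ok_head[OF v _ Suc] label_ok_tail[OF v _ Suc] by blast
    then show ?thesis using Suc by simp
  qed simp
qed

lemma mark_unless_kept_wp:
  assumes w: "n + m + 2 \<le> w" and lab: "sound lab keep" "\<And>v. v < n \<Longrightarrow> lab v \<noteq> 0"
    and s: "marking lab keep s" "regs s ''k'' = k" "k < m" "cells s X k = v" "v < n"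
    and T: "10 + c \<le> T0"
    and Q: "\<And>s' T'. marking lab keep s' \<Longrightarrow> regs s' ''k'' = k \<Longrightarrow>
      cells s' ''out'' = (if lab v = l \<and> keep v \<noteq> Suc k then (cells s ''out'')(k := 1) else cells s ''out'') \<Longrightarrow>
      c \<le> T' \<Longrightarrow> Q s' T'"
  shows "wp w (mark_unless_kept X l) Q s T0"
proof -
  define u where "u = T0 - 10"
  have u: "T0 = u + 10" "c \<le> u" using T by (simp_all add: u_def)
  have m: "regs s ''m'' = m" "cells s ''tail'' = T" "cells s ''head'' = H" "cells s ''L'' = lab" "cells s ''K'' = keep"
    using s(1) by (simp_all add: marking_def)
  have l: "lab v \<le> w" "keep v \<le> w" "v \<le> w" "k \<le> w" "Suc k \<le> w" "Suc 0 \<le> w"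
    using label_keep_le[OF lab(1) lab(2)[OF s(5)]] w s(3,5) by linarith+
  consider "lab v \<noteq> l" | "lab v = l" "keep v = Suc k" | "lab v = l" "keep v \<noteq> Suc k" by blast
  then show ?thesis
  proof cases
    case 1
    then show ?thesis unfolding mark_unless_kept_def u(1)
      by (simp add: wp_simps s m l) (rule Q; use u s in \<open>simp add: marking_def m\<close>)
  next
    case 2
    then show ?thesis unfolding mark_unless_kept_def u(1)
      using l by (simp add: wp_simps s m l) (rule Q; use u s in \<open>simp add: marking_def m\<close>)
  next
    case 3
    then show ?thesis unfolding mark_unless_kept_def u(1)
      using l by (simp add: wp_simps s m l) (rule Q; use u s in \<open>simp add: marking_def m\<close>)
  qed
qed

definition output_upto :: "(nat \<Rightarrow> nat) \<Rightarrow> (nat \<Rightarrow> nat) \<Rightarrow> nat \<Rightarrow> nat \<Rightarrow> nat" where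
  "output_upto lab keep k = (\<lambda>j. if j < k \<and> deleted lab keep j then 1 else 0)"

lemma mark_deleted_wp:
  assumes w: "n + m + 2 \<le> w" and lab: "sound lab keep" "\<And>v. v < n \<Longrightarrow> lab v \<noteq> 0"
    and s: "marking lab keep s" "cells s ''out'' = (\<lambda>_. 0)"
    and T: "30 * m + 2 \<le> T0"
    and Q: "\<And>s' T'. cells s' ''out'' = output_upto lab keep m \<Longrightarrow> Q s' T'"
  shows "wp w mark_deleted Q s T0"
proof -
  define J where "J s T' \<longleftrightarrow> marking lab keep s \<and> regs s ''k'' \<le> m \<and>
    cells s ''out'' = output_upto lab keep (regs s ''k'') \<and> 30 * (m - regs s ''k'') + 1 \<le> T'" for s T'
  have "J (s\<lparr>regs := (regs s)(''k'' := 0)\<rparr>) (T0 - 1)"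
    using s T by (auto simp: J_def marking_def output_upto_def)
  moreover have "0 < T' \<and> (if test_val (Less (Reg ''k'') (Reg ''m'')) s then
      wp w (mark_unless_kept ''head'' 1 ;; mark_unless_kept ''tail'' 2 ;;
        Assign ''k'' (Add (Reg ''k'') (Const 1))) J s (T' - 1)
      else Q s (T' - 1))" if J: "J s T'" for s T'
  proof (cases "regs s ''k'' < m")
    case True
    define k where "k = regs s ''k''"
    have k: "k < m" "Suc k \<le> w" using True w by (simp_all add: k_def)
    have m: "marking lab keep s" "regs s ''k'' = k" using J by (simp_all add: J_def k_def)
    have "30 * (m - k) = 30 * (m - Suc k) + 30" using k by simp
    then have T': "10 + (10 + (1 + (30 * (m - Suc k) + 1))) \<le> T' - 1"
      using J unfolding J_def k_def[symmetric] by linarith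
    have "wp w (mark_unless_kept ''head'' 1 ;; mark_unless_kept ''tail'' 2 ;;
        Assign ''k'' (Add (Reg ''k'') (Const 1))) J s (T' - 1)"
      unfolding wp_Seq_fun
    proof (rule mark_unless_kept_wp[OF w lab m k(1) _ H_less[OF k(1)] T'])
      fix s1 T1
      assume 1: "marking lab keep s1" "regs s1 ''k'' = k"
        "cells s1 ''out'' = (if lab (H k) = 1 \<and> keep (H k) \<noteq> Suc k then (cells s ''out'')(k := 1) else cells s ''out'')"
        "10 + (1 + (30 * (m - Suc k) + 1)) \<le> T1"
      show "wp w (mark_unless_kept ''tail'' 2) (wp w (Assign ''k'' (Add (Reg ''k'') (Const 1))) J) s1 T1"
      proof (rule mark_unless_kept_wp[OF w lab 1(1,2) k(1) _ T_less[OF k(1)] 1(4)])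
        fix s2 T2
        assume 2: "marking lab keep s2" "regs s2 ''k'' = k"
          "cells s2 ''out'' = (if lab (T k) = 2 \<and> keep (T k) \<noteq> Suc k then (cells s1 ''out'')(k := 1) else cells s1 ''out'')"
          "1 + (30 * (m - Suc k) + 1) \<le> T2"
        have "cells s ''out'' = output_upto lab keep k" using J by (simp add: J_def k_def)
        then have "cells s2 ''out'' = output_upto lab keep (Suc k)"
          unfolding 2(3) 1(3) by (auto simp: output_upto_def deleted_def fun_eq_iff less_Suc_eq)
        then show "wp w (Assign ''k'' (Add (Reg ''k'') (Const 1))) J s2 T2"
          using 2 k by (simp add: wp_Assign J_def) (simp add: marking_def)
      qed (use 1(1) in \<open>simp_all add: marking_def\<close>)
    qed (use m(1) in \<open>simp_all add: marking_def\<close>)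
    with J True show ?thesis by (simp add: J_def marking_def)
  next
    case False
    then have "Q s (T' - 1)" using J by (intro Q) (simp add: J_def)
    then show ?thesis using False J by (simp add: J_def marking_def)
  qed
  ultimately have "wp w (While (Less (Reg ''k'') (Reg ''m''))
      (mark_unless_kept ''head'' 1 ;; mark_unless_kept ''tail'' 2 ;;
        Assign ''k'' (Add (Reg ''k'') (Const 1)))) Q (s\<lparr>regs := (regs s)(''k'' := 0)\<rparr>) (T0 - 1)"
    by (rule wp_While)
  then show ?thesis unfolding mark_deleted_def using T by (simp add: wp_Seq wp_Assign)
qed

section \<open>The whole program\<close>

lemma funnel_program_wp:
  assumes w: "n + m + 2 \<le> w" and s: "counted 0 s" "fresh s" "regs s ''k'' = 0"
    and T: "90 * n + 210 * m + 6 \<le> T0"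
  shows "wp w funnel_program (\<lambda>s' T'. \<exists>lab keep. sound lab keep \<and> (\<forall>v<n. lab v \<noteq> 0) \<and>
    cells s' ''out'' = output_upto lab keep m) s T0"
proof -
  \<comment> \<open>The budgets of the four phases, nested as the remaining credits of one
    another.\<close>
  have T0: "20 * m + 1 + (40 * m + 2 + (90 * n + 120 * m + 1 + (30 * m + 2))) \<le> T0" using T by simp
  show ?thesis unfolding funnel_program_def wp_Seq_fun
  proof (rule count_degrees_wp[OF w s T0], erule label_seeds_wp[OF w], assumption, assumption)
    fix s1 T1
    assume 1: "searching s1" "regs s1 ''h'' = 0" "regs s1 ''r'' = 0"
      "\<And>v. v \<in> seeds \<Longrightarrow> cells s1 ''L'' v \<noteq> 0" and T1: "90 * n + 120 * m + 1 + (30 * m + 2) \<le> T1"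
    have "search_inv s1" using 1 by (simp add: search_inv_def)
    then show "wp w search (wp w mark_deleted (\<lambda>s' T'. \<exists>lab keep. sound lab keep \<and> (\<forall>v<n. lab v \<noteq> 0) \<and>
      cells s' ''out'' = output_upto lab keep m)) s1 T1"
    proof (rule search_wp[OF w _ 1(3) T1])
      fix s2 T2
      assume 2: "searching s2" "\<And>v. v < n \<Longrightarrow> cells s2 ''L'' v \<noteq> 0" "30 * m + 2 \<le> T2"
      have "marking (cells s2 ''L'') (cells s2 ''K'') s2"
        using searching_counted[OF 2(1)] by (simp add: marking_def)
      then show "wp w mark_deleted (\<lambda>s' T'. \<exists>lab keep. sound lab keep \<and> (\<forall>v<n. lab v \<noteq> 0) \<and>
        cells s' ''out'' = output_upto lab keep m) s2 T2"
        using 2 searching_sound[OF 2(1)] searching_counted[OF 2(1)]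
        by (intro mark_deleted_wp[OF w, of "cells s2 ''L''" "cells s2 ''K''"]) auto
    qed
  qed
qed

end

section \<open>Presented digraphs\<close>

text \<open>\<open>T\<close> and \<open>H\<close> are the input arrays as functions, including the
  value 0 behind the last arc, so that \<open>counted 0\<close> holds of the input state.\<close>

context
  fixes D :: "'v pair_pre_digraph" and vs :: "'v list" and es :: "(nat \<times> nat) list"
    and T H :: "nat \<Rightarrow> nat" and arc :: "nat \<Rightarrow> 'v \<times> 'v"
  assumes D: "dag D" and P: "presents vs es D"
  defines "T \<equiv> \<lambda>k. if k < length es then fst (es ! k) else 0"
    and "H \<equiv> \<lambda>k. if k < length es then snd (es ! k) else 0"
    and "arc \<equiv> \<lambda>k. named_arc vs (es ! k)"
begin

section \<open>Arc indices and arcs of the digraph\<close>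

lemma tail_head_less: "k < length es \<Longrightarrow> T k < length vs" "k < length es \<Longrightarrow> H k < length vs"
proof -
  assume k: "k < length es"
  then have "es ! k \<in> {..<length vs} \<times> {..<length vs}" using P nth_mem by (fastforce simp: presents_def)
  then show "T k < length vs" "H k < length vs" using k by (auto simp: T_def H_def)
qed

lemma arc_eq: "k < length es \<Longrightarrow> arc k = (vs ! T k, vs ! H k)"
  by (simp add: arc_def T_def H_def named_arc_def split_beta)

lemma arc_image: "arc ` {..<length es} = parcs D"
proof -
  have "(!) es ` {..<length es} = set es"
    using nth_image[of "length es" es] by (simp add: lessThan_atLeast0)
  moreover have "arc ` {..<length es} = named_arc vs ` ((!) es ` {..<length es})"
    by (simp add: arc_def image_image)
  ultimately show ?thesis using P by (simp add: presents_def)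
qed

lemma arc_in_parcs: "k < length es \<Longrightarrow> (vs ! T k, vs ! H k) \<in> parcs D"
  using arc_image arc_eq by (metis imageI lessThan_iff)

lemma inj_on_arc: "inj_on arc {..<length es}"
proof
  fix j k assume jk: "j \<in> {..<length es}" "k \<in> {..<length es}" "arc j = arc k"
  have "distinct vs" using P by (simp add: presents_def)
  with jk have "T j = T k" "H j = H k"
    using tail_head_less by (auto simp: arc_eq nth_eq_iff_index_eq)
  with jk have "es ! j = es ! k" by (simp add: T_def H_def prod_eq_iff)
  then show "j = k" using jk P by (simp add: presents_def nth_eq_iff_index_eq)
qed

text \<open>Both well-foundedness properties are pulled back from the digraph along the numbering of
  the vertices.\<close>

lemma indexed_dag_presented: "indexed_dag (length vs) (length es) T H"
proof
  let ?A = "{(T k, H k) | k. k < length es}"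
  have sub: "?A \<subseteq> inv_image (parcs D) ((!) vs)"
  proof (rule subsetI, elim CollectE exE conjE)
    fix x k assume x: "x = (T k, H k)" and k: "k < length es"
    then show "x \<in> inv_image (parcs D) ((!) vs)" using arc_in_parcs by simp
  qed
  show "wf ?A" by (rule wf_subset[OF wf_inv_image[OF dag_wf(1)[OF D]] sub])
  have "?A\<inverse> \<subseteq> inv_image ((parcs D)\<inverse>) ((!) vs)" using sub by auto
  then show "wf (?A\<inverse>)" by (rule wf_subset[OF wf_inv_image[OF dag_wf(2)[OF D]]])
qed (use tail_head_less in auto)

interpretation indexed_dag "length vs" "length es" T H
  by (rule indexed_dag_presented)

section \<open>The approximation guarantee\<close>

lemma dag_delete_arcs: "dag (delete_arcs D B)"
proof -
  interpret pair_fin_digraph D using D by (simp add: dag_def)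
  have "pair_fin_digraph (delete_arcs D B)"
    by unfold_locales
      (auto simp: delete_arcs_def pair_finite_verts pair_finite_arcs dest: arc_fst_in_verts arc_snd_in_verts)
  moreover have "acyclic (parcs (delete_arcs D B))"
    using D by (auto simp: dag_def delete_arcs_def intro: acyclic_subset)
  ultimately show ?thesis by (simp add: dag_def)
qed

lemma funnel_delete_marked:
  assumes s: "sound lab keep" and all: "\<And>v. v < length vs \<Longrightarrow> lab v \<noteq> 0"
  shows "funnel (delete_arcs D (arc ` {k. k < length es \<and> deleted lab keep k}))" (is "funnel (delete_arcs D ?B)")
proof (rule funnel_if_labelling[OF dag_delete_arcs])
  let ?F = "{vs ! v | v. v < length vs \<and> lab v = 1}"
  have F: "vs ! v \<in> ?F \<longleftrightarrow> lab v = 1" if "v < length vs" for v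
    using that P by (auto simp: presents_def nth_eq_iff_index_eq)
  have ex: "\<exists>k<length es. \<not> deleted lab keep k \<and> x = vs ! T k \<and> y = vs ! H k"
    if xy: "(x, y) \<in> parcs (delete_arcs D ?B)" for x y
  proof -
    from xy arc_image obtain k where "k < length es" "(x, y) = arc k" "\<not> deleted lab keep k"
      by (fastforce simp: delete_arcs_def)
    then show ?thesis by (auto simp: arc_eq)
  qed
  have eq: "vs ! u = vs ! v \<longleftrightarrow> u = v" if "u < length vs" "v < length vs" for u v
    using that P by (auto simp: presents_def nth_eq_iff_index_eq)
  have "\<forall>v<length vs. lab v \<noteq> 0" using all by simp
  note kept = kept_arcs_labelling[OF s this]
  show "funnel_labelling (parcs (delete_arcs D ?B)) ?F"
    unfolding funnel_labelling_def
  proof (intro conjI allI impI)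
    fix u v assume u: "(u, v) \<in> parcs (delete_arcs D ?B)" and v: "v \<in> ?F"
    obtain k where k: "k < length es" "\<not> deleted lab keep k" "u = vs ! T k" "v = vs ! H k"
      using ex[OF u] by blast
    have "lab (H k) = 1" using v F[OF tail_head_less(2)[OF k(1)]] unfolding k(4) by blast
    then have "lab (T k) = 1" by (rule kept(1)[OF k(1) k(1) k(2) k(2)])
    then show "u \<in> ?F" using F[OF tail_head_less(1)[OF k(1)]] unfolding k(3) by blast
  next
    fix u u' v assume v: "v \<in> ?F" and u: "(u, v) \<in> parcs (delete_arcs D ?B)" "(u', v) \<in> parcs (delete_arcs D ?B)"
    obtain k where k: "k < length es" "\<not> deleted lab keep k" "u = vs ! T k" "v = vs ! H k"
      using ex[OF u(1)] by blast
    obtain j where j: "j < length es" "\<not> deleted lab keep j" "u' = vs ! T j" "v = vs ! H j"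
      using ex[OF u(2)] by blast
    have "lab (H j) = 1" using v F[OF tail_head_less(2)[OF j(1)]] unfolding j(4) by blast
    moreover have "H j = H k" using eq[OF tail_head_less(2)[OF j(1)] tail_head_less(2)[OF k(1)]] j(4) k(4) by simp
    ultimately have "j = k" using kept(2)[of j k] j k by blast
    then show "u = u'" using j k by simp
  next
    fix u u' v assume v: "v \<notin> ?F" and u: "(v, u) \<in> parcs (delete_arcs D ?B)" "(v, u') \<in> parcs (delete_arcs D ?B)"
    obtain k where k: "k < length es" "\<not> deleted lab keep k" "v = vs ! T k" "u = vs ! H k"
      using ex[OF u(1)] by blast
    obtain j where j: "j < length es" "\<not> deleted lab keep j" "v = vs ! T j" "u' = vs ! H j"
      using ex[OF u(2)] by blast
    have "lab (T j) \<noteq> 1" using v F[OF tail_head_less(1)[OF j(1)]] unfolding j(3) by blast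
    moreover have "T j = T k" using eq[OF tail_head_less(1)[OF j(1)] tail_head_less(1)[OF k(1)]] j(3) k(3) by simp
    ultimately have "j = k" using kept(3)[of j k] j k by blast
    then show "u = u'" using j k by simp
  qed
qed

text \<open>An optimal deletion set leaves a funnel, whose labelling is pulled back to
  \<open>F'\<close> on vertex numbers. The upper bound for the algorithm and the lower bound for the
  optimum meet in the same sum, with the same \<open>excess F'\<close>.\<close>

lemma card_marked_le:
  assumes s: "sound lab keep" and all: "\<And>v. v < length vs \<Longrightarrow> lab v \<noteq> 0"
  shows "card {k. k < length es \<and> deleted lab keep k} \<le> 2 * funnel_distance D"
proof -
  have "\<exists>k. \<exists>A' \<subseteq> parcs D. funnel (delete_arcs D A') \<and> card A' = k"
    using funnel_delete_all_arcs[OF D] by blast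
  then obtain A' where A': "A' \<subseteq> parcs D" "funnel (delete_arcs D A')" "card A' = funnel_distance D"
    using LeastI_ex[of "\<lambda>k. \<exists>A' \<subseteq> parcs D. funnel (delete_arcs D A') \<and> card A' = k"]
    unfolding funnel_distance_def by blast
  then obtain F where F: "funnel_labelling (parcs D - A') F"
    using funnel_labelling_exists by (fastforce simp: delete_arcs_def)
  define F' where "F' = {v. vs ! v \<in> F}"
  define K where "K = {k. k < length es \<and> arc k \<notin> A'}"
  have K: "(vs ! T k, vs ! H k) \<in> parcs D - A'" "k < length es" if "k \<in> K" for k
    using that arc_in_parcs arc_eq[of k] by (auto simp: K_def)
  have K_eq: "j = k" if "j \<in> K" "k \<in> K" "vs ! T j = vs ! T k" "vs ! H j = vs ! H k" for j k
    using that inj_on_arc K(2) by (auto simp: inj_on_def arc_eq)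
  have "card {k. k < length es \<and> deleted lab keep k}
      \<le> (\<Sum>v<length vs. min (indeg v) (outdeg v) - 1) + card (excess F')"
    by (rule deletions_upper_bound[OF s all])
  also have "\<dots> \<le> 2 * card ({..<length es} - K)"
  proof (rule deletions_lower_bound)
    show "K \<subseteq> {..<length es}" by (auto simp: K_def)
    show "T k \<in> F'" if "k \<in> K" "H k \<in> F'" for k
      using that F K(1)[of k] unfolding F'_def funnel_labelling_def by blast
    show "j = k" if jk: "j \<in> K" "k \<in> K" "H j = H k" "H j \<in> F'" for j k
    proof (rule K_eq[OF jk(1,2)])
      show "vs ! T j = vs ! T k"
        using jk(3,4) F K(1)[OF jk(1)] K(1)[OF jk(2)] unfolding F'_def funnel_labelling_def
        by (metis mem_Collect_eq)
    qed (use jk in simp)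
    show "j = k" if jk: "j \<in> K" "k \<in> K" "T j = T k" "T j \<notin> F'" for j k
    proof (rule K_eq[OF jk(1,2)])
      show "vs ! H j = vs ! H k"
        using jk(3,4) F K(1)[OF jk(1)] K(1)[OF jk(2)] unfolding F'_def funnel_labelling_def
        by (metis mem_Collect_eq)
    qed (use jk in simp)
  qed
  also have "card ({..<length es} - K) \<le> card A'"
  proof (rule card_inj_on_le)
    show "inj_on arc ({..<length es} - K)" by (rule inj_on_subset[OF inj_on_arc]) auto
    show "arc ` ({..<length es} - K) \<subseteq> A'" by (auto simp: K_def)
    show "finite A'" using A'(1) arc_image by (metis finite_imageI finite_lessThan finite_subset)
  qed
  finally show ?thesis using A'(3) by simp
qed

text \<open>The number \<open>c\<close> serves as word size and as time bound: it exceeds both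
  \<open>n + m + 2\<close> and \<open>90 * n + 210 * m + 6\<close>.\<close>

lemma funnel_program_correct:
  fixes c :: nat
  assumes "c = 300 * (card (pverts D) + card (parcs D) + 1)"
  shows "\<exists>t s. run c funnel_program (input_state (length vs) es) t s \<and> t \<le> c \<and>
    output_arcs vs es s \<subseteq> parcs D \<and> funnel (delete_arcs D (output_arcs vs es s)) \<and>
    card (output_arcs vs es s) \<le> 2 * funnel_distance D"
proof -
  have "card (pverts D) = length vs" using P distinct_card by (fastforce simp: presents_def)
  moreover have "card (parcs D) = length es" using card_image[OF inj_on_arc] arc_image by simp
  ultimately have c: "c = 300 * (length vs + length es + 1)" using assms by simp
  let ?s = "input_state (length vs) es"
  have "wp c funnel_program (\<lambda>s' T'. \<exists>lab keep. sound lab keep \<and> (\<forall>v<length vs. lab v \<noteq> 0) \<and>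
      cells s' ''out'' = output_upto lab keep (length es)) ?s c"
  proof (rule funnel_program_wp)
    show "counted 0 ?s"
      unfolding counted_def by (simp add: input_state_def T_def H_def occurrences_0 links_0)
    show "fresh ?s" unfolding fresh_def by (simp add: input_state_def)
    show "regs ?s ''k'' = 0" by (simp add: input_state_def)
  qed (simp_all add: c)
  then obtain t s lab keep where r: "run c funnel_program ?s t s" "t \<le> c"
    and s: "sound lab keep" "\<And>v. v < length vs \<Longrightarrow> lab v \<noteq> 0"
    and out: "cells s ''out'' = output_upto lab keep (length es)"
    unfolding wp_def by blast
  let ?X = "{k. k < length es \<and> deleted lab keep k}"
  have o: "output_arcs vs es s = arc ` ?X"
    unfolding output_arcs_def out output_upto_def arc_def by auto
  have "arc ` ?X \<subseteq> parcs D" using arc_image by auto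
  moreover have "card (arc ` ?X) \<le> 2 * funnel_distance D"
    using card_image_le[of ?X arc] card_marked_le[OF s] by simp
  ultimately show ?thesis using r funnel_delete_marked[OF s] unfolding o[symmetric] by blast
qed

end

theorem theorem3:
  shows "\<exists>P c. \<forall>(D :: 'v pair_pre_digraph) vs es.
    dag D \<and> presents vs es D \<longrightarrow>
      (\<exists>t s. run (c * (card (pverts D) + card (parcs D) + 1)) P (input_state (length vs) es) t s \<and>
             t \<le> c * (card (pverts D) + card (parcs D) + 1) \<and>
             output_arcs vs es s \<subseteq> parcs D \<and>
             funnel (delete_arcs D (output_arcs vs es s)) \<and>
             card (output_arcs vs es s) \<le> 2 * funnel_distance D)"
  \<comment> \<open>The witnesses are \<open>funnel_program\<close> and 300, both fixed before the
    digraph is given.\<close>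
  using funnel_program_correct by blast

end
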